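(* Let $\mathcal{H}$ be a reproducing kernel Hilbert space on a non-empty set $\Omega$, and let $A\in\mathcal{B}(\mathcal{H})$. Then for all $r\geq 1$ and all $\alpha\in[0,1]$, $$\mathbf{ber}^{2r}(A) \leq \frac{\alpha}{2}\mathbf{ber}^r(A^2)+\mathbf{ber}\left( \frac{\alpha}{4}|A|^{2r}+\left(1-\frac{3}{4}\alpha\right)|A^*|^{2r}\right)$$ and $$\mathbf{ber}^{2r}(A) \leq \frac{\alpha}{2}\mathbf{ber}^r(A^2)+\mathbf{ber}\left( \left(1-\frac{3}{4}\alpha\right)|A|^{2r}+\frac{\alpha}{4}|A^*|^{2r}\right).$$
   Context: Let $\mathbb{F}$ be $\mathbb{R}$ or $\mathbb{C}$ and $\Omega$ a non-empty set. A reproducing kernel Hilbert space $\mathcal{H}$ on $\Omega$ is a Hilbert space over $\mathbb{F}$ consisting of functions $\Omega\to\mathbb{F}$ such that every evaluation $f\mapsto f(\lambda)$, $\lambda\in\Omega$, is bounded. For $\lambda\in\Omega$, $k_\lambda\in\mathcal{H}$ is the unique vector with $f(\lambda)=\langle f,k_\lambda\rangle$ for all $f\in\mathcal{H}$; it is assumed that $k_\lambda\neq 0$ for every $\lambda$, and $\hat{k}_\lambda=k_\lambda/\|k_\lambda\|$. $\mathcal{B}(\mathcal{H})$ is the set of bounded linear operators on $\mathcal{H}$. The Berezin number of $A\in\mathcal{B}(\mathcal{H})$ is $\mathbf{ber}(A)=\sup_{\lambda\in\Omega}|\langle A\hat{k}_\lambda,\hat{k}_\lambda\rangle|$, and $\mathbf{ber}^{s}(A)$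 means $(\mathbf{ber}(A))^{s}$. $|A|=(A^*A)^{1/2}$ and $|A^*|=(AA^* )^{1/2}$; real powers of positive operators are taken by the continuous functional calculus. *)

theory Defs
  imports "HOL-Analysis.Analysis" "HOL-Computational_Algebra.Polynomial"
begin

text \<open>
  The real and the complex case are treated together: the scalar field is a subset of the
  complex numbers, either \<open>\<real>\<close> or \<open>UNIV\<close>, and a function into the reals is a function into the
  complex numbers with values in \<open>\<real>\<close>. The non-empty set on which the functions live is the
  type \<open>'a\<close>.
\<close>

record 'a fun_space =
  scalars :: "complex set"
  vectors :: "('a \<Rightarrow> complex) set"
  ip :: "('a \<Rightarrow> complex) \<Rightarrow> ('a \<Rightarrow> complex) \<Rightarrow> complex"

definition hnorm :: "'a fun_space \<Rightarrow> ('a \<Rightarrow> complex) \<Rightarrow> real" where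
  "hnorm X f = sqrt (Re (ip X f f))"

locale rkhs =
  fixes X :: "'a fun_space"
  assumes scalars: "scalars X = \<real> \<or> scalars X = UNIV"
    and vectors_value: "f \<in> vectors X \<Longrightarrow> f x \<in> scalars X"
    and vectors_zero: "(\<lambda>x. 0) \<in> vectors X"
    and vectors_add: "\<lbrakk>f \<in> vectors X; g \<in> vectors X\<rbrakk> \<Longrightarrow> (\<lambda>x. f x + g x) \<in> vectors X"
    and vectors_scale: "\<lbrakk>c \<in> scalars X; f \<in> vectors X\<rbrakk> \<Longrightarrow> (\<lambda>x. c * f x) \<in> vectors X"
    and ip_value: "\<lbrakk>f \<in> vectors X; g \<in> vectors X\<rbrakk> \<Longrightarrow> ip X f g \<in> scalars X"
    and ip_add: "\<lbrakk>f \<in> vectors X; g \<in> vectors X; h \<in> vectors X\<rbrakk>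
      \<Longrightarrow> ip X (\<lambda>x. f x + g x) h = ip X f h + ip X g h"
    and ip_scale: "\<lbrakk>c \<in> scalars X; f \<in> vectors X; g \<in> vectors X\<rbrakk>
      \<Longrightarrow> ip X (\<lambda>x. c * f x) g = c * ip X f g"
    and ip_cnj: "\<lbrakk>f \<in> vectors X; g \<in> vectors X\<rbrakk> \<Longrightarrow> ip X g f = cnj (ip X f g)"
    and ip_nonneg: "f \<in> vectors X \<Longrightarrow> Re (ip X f f) \<ge> 0"
    and ip_definite: "\<lbrakk>f \<in> vectors X; ip X f f = 0\<rbrakk> \<Longrightarrow> f = (\<lambda>x. 0)"
    and complete: "\<lbrakk>\<And>n::nat. u n \<in> vectors X;
        \<forall>e>0. \<exists>N. \<forall>m\<ge>N. \<forall>n\<ge>N. hnorm X (\<lambda>x. u m x - u n x) < e\<rbrakk>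
      \<Longrightarrow> \<exists>f\<in>vectors X. (\<lambda>n. hnorm X (\<lambda>x. u n x - f x)) \<longlonglongrightarrow> 0"
    and evaluation_bounded: "\<exists>C. \<forall>f\<in>vectors X. cmod (f x) \<le> C * hnorm X f"

definition repr_kernel :: "'a fun_space \<Rightarrow> 'a \<Rightarrow> 'a \<Rightarrow> complex" where
  "repr_kernel X l = (THE k. k \<in> vectors X \<and> (\<forall>f\<in>vectors X. f l = ip X f k))"

definition normalized_kernel :: "'a fun_space \<Rightarrow> 'a \<Rightarrow> 'a \<Rightarrow> complex" where
  "normalized_kernel X l = (\<lambda>x. repr_kernel X l x / complex_of_real (hnorm X (repr_kernel X l)))"

type_synonym 'a op = "('a \<Rightarrow> complex) \<Rightarrow> ('a \<Rightarrow> complex)"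

text \<open>
  An operator on the space is represented by a total function on all of \<open>'a \<Rightarrow> complex\<close>. Only
  its values on \<open>vectors X\<close> matter, and nothing is required of it elsewhere.
\<close>

definition bounded_ops :: "'a fun_space \<Rightarrow> 'a op set" where
  "bounded_ops X = {A.
     (\<forall>f\<in>vectors X. A f \<in> vectors X) \<and>
     (\<forall>f\<in>vectors X. \<forall>g\<in>vectors X. A (\<lambda>x. f x + g x) = (\<lambda>x. A f x + A g x)) \<and>
     (\<forall>c\<in>scalars X. \<forall>f\<in>vectors X. A (\<lambda>x. c * f x) = (\<lambda>x. c * A f x)) \<and>
     (\<exists>C. \<forall>f\<in>vectors X. hnorm X (A f) \<le> C * hnorm X f)}"

definition op_norm :: "'a fun_space \<Rightarrow> 'a op \<Rightarrow> real" where
  "op_norm X A = (SUP f\<in>{f \<in> vectors X. hnorm X f \<le> 1}. hnorm X (A f))"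

definition adj :: "'a fun_space \<Rightarrow> 'a op \<Rightarrow> 'a op" where
  "adj X A g = (THE h. h \<in> vectors X \<and> (\<forall>f\<in>vectors X. ip X (A f) g = ip X f h))"

definition op_lincomb :: "real \<Rightarrow> 'a op \<Rightarrow> real \<Rightarrow> 'a op \<Rightarrow> 'a op" where
  "op_lincomb a S b T = (\<lambda>f x. complex_of_real a * S f x + complex_of_real b * T f x)"

definition op_spectrum :: "'a fun_space \<Rightarrow> 'a op \<Rightarrow> complex set" where
  "op_spectrum X T = {c \<in> scalars X. \<not> (\<exists>S\<in>bounded_ops X. \<forall>f\<in>vectors X.
     S (\<lambda>x. T f x - c * f x) = f \<and> (\<lambda>x. T (S f) x - c * S f x) = f)}"

definition op_poly :: "real poly \<Rightarrow> 'a op \<Rightarrow> 'a op" where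
  "op_poly p T = (\<lambda>f x. \<Sum>i\<le>degree p. complex_of_real (coeff p i) * (T ^^ i) f x)"

text \<open>
  Continuous functional calculus of a self-adjoint operator \<open>T\<close>, whose spectrum is real, for a
  real function \<open>\<phi>\<close> that is continuous on the spectrum: the limit in operator norm of \<open>p\<^sub>n(T)\<close>
  for polynomials \<open>p\<^sub>n\<close> tending to \<open>\<phi>\<close> uniformly on the spectrum. The operator is determined
  by this on \<open>vectors X\<close>; the choice only concerns its irrelevant values elsewhere.
\<close>

definition cfc :: "'a fun_space \<Rightarrow> (real \<Rightarrow> real) \<Rightarrow> 'a op \<Rightarrow> 'a op" where
  "cfc X \<phi> T = (SOME S. S \<in> bounded_ops X \<and>
     (\<forall>p :: nat \<Rightarrow> real poly.
        uniform_limit {t. complex_of_real t \<in> op_spectrum X T} (\<lambda>n. poly (p n)) \<phi> sequentially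
        \<longrightarrow> (\<lambda>n. op_norm X (op_lincomb 1 (op_poly (p n) T) (- 1) S)) \<longlonglongrightarrow> 0))"

text \<open>
  Only exponents \<open>s > 0\<close> are meant: \<open>0 powr 0 = 0\<close>, so exponent \<open>0\<close> need not give the identity.
\<close>

definition op_powr :: "'a fun_space \<Rightarrow> 'a op \<Rightarrow> real \<Rightarrow> 'a op" where
  "op_powr X T s = cfc X (\<lambda>t. t powr s) T"

definition modulus :: "'a fun_space \<Rightarrow> 'a op \<Rightarrow> 'a op" where
  "modulus X A = op_powr X (adj X A \<circ> A) (1 / 2)"

definition ber :: "'a fun_space \<Rightarrow> 'a op \<Rightarrow> real" where
  "ber X A = (SUP l. cmod (ip X (A (normalized_kernel X l)) (normalized_kernel X l)))"

end

theory Submission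
  imports Defs "HOL-Library.Function_Algebras" "HOL-Computational_Algebra.Fundamental_Theorem_Algebra"
begin

text \<open>
  The inequality holds pointwise, for every unit vector \<open>x\<close>, before any supremum is taken. Put
  \<open>a = \<parallel>A x\<parallel>\<close>, \<open>b = \<parallel>A\<^sup>* x\<parallel>\<close>, \<open>w = \<bar>\<langle>A x, x\<rangle>\<bar>\<close> and \<open>z = \<bar>\<langle>A\<^sup>2 x, x\<rangle>\<bar>\<close>. Cauchy-Schwarz gives
  \<open>w \<le> a\<close> and \<open>w \<le> b\<close>, and Buzano's inequality for the vectors \<open>A x\<close> and \<open>A\<^sup>* x\<close> gives
  \<open>2 w\<^sup>2 \<le> a b + z\<close> (lemma \<open>buzano_square\<close>). Writing \<open>w\<^sup>2\<^sup>r\<close> as the mixture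
  \<open>\<alpha> w\<^sup>2\<^sup>r + (1 - \<alpha>) w\<^sup>2\<^sup>r\<close>, estimating the first part by Buzano and convexity of \<open>t\<^sup>r\<close>, and the
  second one by \<open>w \<le> b\<close> (or by \<open>w \<le> a\<close>, for the second inequality), one arrives at
  \<open>\<alpha>/2 z\<^sup>r\<close> plus a combination of \<open>a\<^sup>2\<^sup>r\<close> and \<open>b\<^sup>2\<^sup>r\<close> with the required coefficients
  (\<open>power_mean_step\<close>). It remains to see that \<open>\<parallel>A x\<parallel>\<^sup>2\<^sup>r \<le> \<langle>\<bar>A\<bar>\<^sup>2\<^sup>r x, x\<rangle>\<close>, which is Jensen's
  inequality for the spectral measure of \<open>\<bar>A\<bar>\<close> (\<open>hnorm_powr_le_modulus_power\<close>), used for \<open>A\<close> and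
  for \<open>A\<^sup>*\<close>.

  Most of the text builds the continuous functional calculus, which is needed to know that
  the operators \<open>\<bar>A\<bar>\<close> and \<open>\<bar>A\<bar>\<^sup>2\<^sup>r\<close> exist at all and to prove that last inequality. Only the real part
  \<open>Re \<langle>f, g\<rangle>\<close> of the inner product and the real points of the spectrum enter it, so it is done once
  for real Hilbert spaces, and covers both scalar fields. The steps are these.

  \<^item> Minimising a quadratic functional solves \<open>S u = g\<close> weakly for symmetric coercive \<open>S\<close>
    (\<open>symmetric_lax_milgram\<close>). With \<open>S\<close> the identity this is the Riesz representation theorem,
    hence the existence of kernels and adjoints; applied to \<open>S\<^sup>2\<close> it shows that a symmetric
    operator that is bounded below is invertible.

  \<^item> If a real polynomial \<open>q\<close> has no zero in the spectrum of a symmetric \<open>T\<close>, then \<open>q(T)\<close> is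
    invertible: split \<open>q\<close> into real linear and quadratic factors (\<open>papp_invertible\<close>).
    Conversely \<open>S\<^sup>2 - \<parallel>S\<parallel>\<^sup>2\<close> is never invertible. For \<open>S = p(T)\<close> these two facts give
    \<open>\<parallel>p(T)\<parallel> \<le> sup \<bar>p\<bar>\<close>, the supremum being over the spectrum (\<open>papp_norm_bound\<close>).

  \<^item> This norm bound turns uniform approximation of \<open>\<phi>\<close> by polynomials into operator-norm
    convergence, which gives \<open>\<phi>(T)\<close>, and shows that \<open>q \<le> \<phi>\<close> on the spectrum implies
    \<open>\<langle>q(T) f, f\<rangle> \<le> \<langle>\<phi>(T) f, f\<rangle>\<close>. Jensen's inequality follows by taking for \<open>q\<close> a tangent to
    \<open>\<phi>\<close>.
\<close>

section \<open>Inequalities between real powers and numbers\<close>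

text \<open>
  Convexity of \<open>u\<^sup>r\<close>, in the form that Young's inequality for the numbers \<open>u\<close> and
  \<open>v\<^sup>r\<^sup>-\<^sup>1\<close> with the conjugate exponents \<open>r\<close> and \<open>r/(r - 1)\<close> yields directly, also at the
  boundary point \<open>u = 0\<close>.
\<close>

lemma powr_above_tangent:
  fixes u v r :: real
  assumes "u \<ge> 0" "v > 0" "r \<ge> 1"
  shows "v powr r + r * v powr (r - 1) * (u - v) \<le> u powr r"
proof (cases "r = 1")
  case False
  then have r: "r > 1" using assms by simp
  have "u * v powr (r - 1) \<le> u powr r / r + (v powr (r - 1)) powr (r / (r - 1)) / (r / (r - 1))"
    using r assms by (intro Youngs_inequality) (auto simp: field_simps)
  also have "(v powr (r - 1)) powr (r / (r - 1)) = v powr r"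
    using r by (simp add: powr_powr)
  finally have "r * (u * v powr (r - 1)) \<le> u powr r + (r - 1) * v powr r"
    using r by (simp add: field_simps)
  moreover have "v powr (r - 1) * v = v powr r"
    using assms powr_add[of v "r - 1" 1] by simp
  ultimately show ?thesis
    by (simp add: algebra_simps)
qed (use assms in simp)

text \<open>
  The two tangent inequalities at the midpoint add up to this one, as their linear terms cancel.
\<close>

lemma powr_midpoint_convex:
  fixes u v r :: real
  assumes "u \<ge> 0" "v \<ge> 0" "r \<ge> 1"
  shows "((u + v) / 2) powr r \<le> (u powr r + v powr r) / 2"
proof (cases "u + v = 0")
  case False
  define m where "m = (u + v) / 2"
  have m: "m > 0" using False assms by (simp add: m_def)
  have "u - m + (v - m) = 0" by (simp add: m_def)
  then have "r * m powr (r - 1) * (u - m) + r * m powr (r - 1) * (v - m) = 0"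
    by (simp flip: distrib_left)
  then show ?thesis
    using powr_above_tangent[OF assms(1) m assms(3)] powr_above_tangent[OF assms(2) m assms(3)]
    unfolding m_def [symmetric] by simp
qed (use assms in simp)

lemma powr_power2:
  fixes t r :: real
  assumes "t \<ge> 0"
  shows "(t\<^sup>2) powr r = t powr (2 * r)"
proof -
  have "(t\<^sup>2) powr r = (t powr 2) powr r"
    using assms by simp
  then show ?thesis by (simp only: powr_powr)
qed

text \<open>
  The numerical content of the theorem. The weight \<open>\<alpha>\<close> goes to the estimate
  \<open>w\<^sup>2\<^sup>r \<le> ((a b + z)/2)\<^sup>r \<le> z\<^sup>r/2 + (a\<^sup>2\<^sup>r + b\<^sup>2\<^sup>r)/4\<close>, the weight \<open>1 - \<alpha>\<close> to \<open>w\<^sup>2\<^sup>r \<le> b\<^sup>2\<^sup>r\<close>, so that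
  \<open>b\<^sup>2\<^sup>r\<close> collects \<open>\<alpha>/4 + (1 - \<alpha>) = 1 - 3/4 \<alpha>\<close>.
\<close>

lemma power_mean_step:
  fixes a b w z r \<alpha> :: real
  assumes nonneg: "0 \<le> a" "0 \<le> b" "0 \<le> w" "0 \<le> z" and r: "r \<ge> 1" and \<alpha>: "\<alpha> \<in> {0..1}"
    and wb: "w \<le> b" and buz: "2 * w\<^sup>2 \<le> a * b + z"
  shows "w powr (2 * r) \<le> \<alpha> / 2 * z powr r + (\<alpha> / 4 * a powr (2 * r) + (1 - 3 / 4 * \<alpha>) * b powr (2 * r))"
proof -
  have "w powr (2 * r) = (w\<^sup>2) powr r"
    using nonneg(3) by (rule powr_power2 [symmetric])
  also have "\<dots> \<le> ((a * b + z) / 2) powr r"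
    using buz nonneg r by (intro powr_mono2) auto
  also have "\<dots> \<le> ((a * b) powr r + z powr r) / 2"
    using nonneg r by (intro powr_midpoint_convex) auto
  also have "(a * b) powr r \<le> (a powr (2 * r) + b powr (2 * r)) / 2"
  proof -
    have "0 \<le> (a powr r - b powr r)\<^sup>2" by simp
    also have "\<dots> = a powr (2 * r) + b powr (2 * r) - 2 * (a powr r * b powr r)"
      by (simp add: power2_eq_square algebra_simps flip: powr_add)
    finally show ?thesis using nonneg by (simp add: powr_mult)
  qed
  finally have 1: "w powr (2 * r) \<le> z powr r / 2 + a powr (2 * r) / 4 + b powr (2 * r) / 4"
    by (simp add: add_divide_distrib)
  have 2: "w powr (2 * r) \<le> b powr (2 * r)"
    using wb nonneg r by (intro powr_mono2) auto
  have "w powr (2 * r) = \<alpha> * w powr (2 * r) + (1 - \<alpha>) * w powr (2 * r)"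
    by (simp add: algebra_simps)
  also have "\<dots> \<le> \<alpha> * (z powr r / 2 + a powr (2 * r) / 4 + b powr (2 * r) / 4)
      + (1 - \<alpha>) * b powr (2 * r)"
    using \<alpha> 1 2 by (intro add_mono mult_left_mono) auto
  finally show ?thesis by (simp add: algebra_simps)
qed

lemma le_if_le_plus_multiples:
  fixes a b K :: real
  assumes "\<And>e. 0 < e \<Longrightarrow> a \<le> b + e * K"
  shows "a \<le> b"
proof (rule field_le_epsilon)
  fix e :: real assume "e > 0"
  then have "a \<le> b + e / (\<bar>K\<bar> + 1) * K" by (intro assms) simp
  also have "e / (\<bar>K\<bar> + 1) * K \<le> e"
  proof -
    have "e * K \<le> e * (\<bar>K\<bar> + 1)" using \<open>e > 0\<close> by (intro mult_left_mono) auto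
    then show ?thesis by (simp add: field_simps)
  qed
  finally show "a \<le> b + e" by simp
qed

text \<open>
  A quadratic function of \<open>t\<close> with minimum at \<open>t = 0\<close> has no linear term; this is how the
  Euler equation is read off from a minimum below.
\<close>

lemma quadratic_nonneg_imp_zero:
  fixes d q :: real
  assumes "0 \<le> q" "\<And>t. 0 \<le> 2 * t * d + t\<^sup>2 * q"
  shows "d = 0"
proof (rule ccontr)
  assume "d \<noteq> 0"
  \<comment> \<open>The minimiser is \<open>- d / q\<close>; the summand \<open>1\<close> covers the case \<open>q = 0\<close>.\<close>
  have "0 \<le> 2 * (- d / (q + 1)) * d + (- d / (q + 1))\<^sup>2 * q"
    using assms(2) .
  also have "\<dots> = - (d\<^sup>2 * (q + 2) / (q + 1)\<^sup>2)"
    using assms(1) by (simp add: power2_eq_square divide_simps) (simp add: algebra_simps)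
  also have "\<dots> < 0"
    using \<open>d \<noteq> 0\<close> assms(1) by simp
  finally show False by simp
qed

section \<open>Real polynomials: approximation and non-real roots\<close>

lemma poly_approx_on_interval:
  fixes \<phi> :: "real \<Rightarrow> real"
  assumes "continuous_on {a..b} \<phi>" "e > 0"
  shows "\<exists>q. \<forall>t\<in>{a..b}. \<bar>poly q t - \<phi> t\<bar> \<le> e"
proof -
  obtain g where g: "real_polynomial_function g" "\<And>t. t \<in> {a..b} \<Longrightarrow> \<bar>\<phi> t - g t\<bar> < e"
    using Stone_Weierstrass_real_polynomial_function[of "{a..b}" \<phi> e] assms by auto
  obtain c n where "g = (\<lambda>x. \<Sum>i\<le>n. c i * x ^ i)"
    using g(1) real_polynomial_function_iff_sum by blast
  then have "poly (\<Sum>i\<le>n. monom (c i) i) t = g t" for t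
    by (simp add: poly_sum poly_monom)
  then show ?thesis
    using g(2) by (intro exI[of _ "\<Sum>i\<le>n. monom (c i) i"]) (force simp: abs_minus_commute)
qed

lemma poly_map_of_real_add:
  "poly (map_poly of_real (p + q)) z
    = poly (map_poly of_real p) z + poly (map_poly complex_of_real q) z"
  by (induction p q rule: poly_induct2) (simp_all add: map_poly_pCons algebra_simps)

lemma poly_map_of_real_smult:
  "poly (map_poly of_real (smult a p)) z = of_real a * poly (map_poly complex_of_real p) z"
  by (induction p) (simp_all add: map_poly_pCons algebra_simps)

lemma poly_map_of_real_mult:
  "poly (map_poly of_real (p * q)) z
    = poly (map_poly of_real p) z * poly (map_poly complex_of_real q) z"
  by (induction p)
    (simp_all add: map_poly_pCons poly_map_of_real_add poly_map_of_real_smult algebra_simps)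

lemma poly_map_of_real_of_real:
  "poly (map_poly complex_of_real p) (of_real x) = of_real (poly p x)"
  by (induction p) (simp_all add: map_poly_pCons)

text \<open>
  The remainder of \<open>q\<close> modulo the minimal polynomial of \<open>z\<close> is linear with real coefficients and
  vanishes at the non-real point \<open>z\<close>, so it is zero.
\<close>

lemma nonreal_root_quadratic_dvd:
  fixes q :: "real poly" and z :: complex
  assumes "poly (map_poly of_real q) z = 0" "Im z \<noteq> 0"
  shows "[:(Re z)\<^sup>2 + (Im z)\<^sup>2, - 2 * Re z, 1:] dvd q"
proof -
  define d where "d = [:(Re z)\<^sup>2 + (Im z)\<^sup>2, - 2 * Re z, 1:]"
  define s where "s = q mod d"
  have deg_d: "degree d = 2" "d \<noteq> 0" by (simp_all add: d_def)
  have "degree s < 2 \<or> s = 0"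
    using degree_mod_less[of d q] deg_d s_def by auto
  then have "degree s \<le> 1" by auto
  then obtain a b where ab: "s = [:a, b:]"
    by (metis degree_eq_zeroE degree1_coeffs le_eq_less_or_eq less_one pCons_0_0)
  have root_d: "poly (map_poly of_real d) z = 0"
    by (cases z) (simp add: d_def map_poly_pCons complex_eq_iff power2_eq_square algebra_simps)
  have "q = d * (q div d) + s"
    by (simp add: s_def)
  then have "poly (map_poly of_real (d * (q div d) + s)) z = 0"
    using assms(1) by simp
  then have "poly (map_poly of_real s) z = 0"
    using root_d by (simp add: poly_map_of_real_add poly_map_of_real_mult)
  then have "complex_of_real a + z * complex_of_real b = 0"
    by (simp add: ab map_poly_pCons)
  then have "b = 0" "a = 0"
    using assms(2) by (auto simp: complex_eq_iff)
  then have "s = 0" by (simp add: ab)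
  then show ?thesis
    unfolding s_def d_def by (simp add: mod_eq_0_iff_dvd)
qed

section \<open>Real Hilbert spaces carried by a subset of a vector space\<close>

text \<open>
  The Hilbert space is a subset \<open>V\<close> of a real vector space, with its own inner product that
  means nothing outside \<open>V\<close>. Spaces that vary inside a statement cannot be types, and the
  function spaces at issue all live in the same type of functions.
\<close>

locale real_hilbert =
  fixes V :: "'v::real_vector set" and inn :: "'v \<Rightarrow> 'v \<Rightarrow> real"
  assumes zero_mem [simp]: "0 \<in> V"
    and add_mem [simp]: "\<lbrakk>f \<in> V; g \<in> V\<rbrakk> \<Longrightarrow> f + g \<in> V"
    and scale_mem [simp]: "f \<in> V \<Longrightarrow> c *\<^sub>R f \<in> V"
    and inn_add_left: "\<lbrakk>f \<in> V; g \<in> V; h \<in> V\<rbrakk> \<Longrightarrow> inn (f + g) h = inn f h + inn g h"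
    and inn_scale_left: "\<lbrakk>f \<in> V; g \<in> V\<rbrakk> \<Longrightarrow> inn (c *\<^sub>R f) g = c * inn f g"
    and inn_commute: "\<lbrakk>f \<in> V; g \<in> V\<rbrakk> \<Longrightarrow> inn f g = inn g f"
    and inn_nonneg: "f \<in> V \<Longrightarrow> 0 \<le> inn f f"
    and inn_definite: "\<lbrakk>f \<in> V; inn f f = 0\<rbrakk> \<Longrightarrow> f = 0"
    and cauchy_converges: "\<lbrakk>\<And>n::nat. u n \<in> V;
        \<forall>e>0. \<exists>N. \<forall>m\<ge>N. \<forall>n\<ge>N. sqrt (inn (u m - u n) (u m - u n)) < e\<rbrakk>
      \<Longrightarrow> \<exists>f\<in>V. (\<lambda>n. sqrt (inn (u n - f) (u n - f))) \<longlonglongrightarrow> 0"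
begin

definition nrm :: "'v \<Rightarrow> real" where
  "nrm f = sqrt (inn f f)"

lemma minus_mem [simp]: "f \<in> V \<Longrightarrow> - f \<in> V"
  using scale_mem[of f "-1"] by simp

lemma diff_mem [simp]: "\<lbrakk>f \<in> V; g \<in> V\<rbrakk> \<Longrightarrow> f - g \<in> V"
  using add_mem[of f "- g"] by simp

lemma inn_add_right: "\<lbrakk>f \<in> V; g \<in> V; h \<in> V\<rbrakk> \<Longrightarrow> inn h (f + g) = inn h f + inn h g"
  by (metis add_mem inn_add_left inn_commute)

lemma inn_scale_right: "\<lbrakk>f \<in> V; g \<in> V\<rbrakk> \<Longrightarrow> inn g (c *\<^sub>R f) = c * inn g f"
  by (metis scale_mem inn_scale_left inn_commute)

lemma inn_minus_left: "\<lbrakk>f \<in> V; g \<in> V\<rbrakk> \<Longrightarrow> inn (- f) g = - inn f g"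
  using inn_scale_left[of f g "-1"] by simp

lemma inn_minus_right: "\<lbrakk>f \<in> V; g \<in> V\<rbrakk> \<Longrightarrow> inn g (- f) = - inn g f"
  using inn_scale_right[of f g "-1"] by simp

lemma inn_diff_left: "\<lbrakk>f \<in> V; g \<in> V; h \<in> V\<rbrakk> \<Longrightarrow> inn (f - g) h = inn f h - inn g h"
  using inn_add_left[of f "- g" h] by (simp add: inn_minus_left)

lemma inn_diff_right: "\<lbrakk>f \<in> V; g \<in> V; h \<in> V\<rbrakk> \<Longrightarrow> inn h (f - g) = inn h f - inn h g"
  using inn_add_right[of f "- g" h] by (simp add: inn_minus_right)

lemma inn_zero [simp]: "f \<in> V \<Longrightarrow> inn 0 f = 0" "f \<in> V \<Longrightarrow> inn f 0 = 0"
  using inn_scale_left[of f f 0] inn_scale_right[of f f 0] by auto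

lemmas inn_simps = inn_add_left inn_add_right inn_diff_left inn_diff_right
  inn_scale_left inn_scale_right inn_minus_left inn_minus_right

lemma nrm_nonneg [simp]: "f \<in> V \<Longrightarrow> 0 \<le> nrm f"
  by (simp add: nrm_def inn_nonneg)

lemma nrm_sq: "f \<in> V \<Longrightarrow> (nrm f)\<^sup>2 = inn f f"
  by (simp add: nrm_def inn_nonneg)

lemma nrm_zero [simp]: "nrm 0 = 0"
  by (simp add: nrm_def)

lemma nrm_eq_0 [simp]: "f \<in> V \<Longrightarrow> nrm f = 0 \<longleftrightarrow> f = 0"
  using inn_definite by (auto simp: nrm_def)

lemma nrm_scale: "f \<in> V \<Longrightarrow> nrm (c *\<^sub>R f) = \<bar>c\<bar> * nrm f"
  by (simp add: nrm_def inn_simps real_sqrt_mult flip: power2_eq_square mult.assoc)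

lemma nrm_minus_commute: "\<lbrakk>f \<in> V; g \<in> V\<rbrakk> \<Longrightarrow> nrm (f - g) = nrm (g - f)"
  using nrm_scale[of "g - f" "-1"] by simp

lemma cauchy_schwarz:
  assumes "f \<in> V" "g \<in> V"
  shows "\<bar>inn f g\<bar> \<le> nrm f * nrm g"
proof (cases "g = 0")
  case False
  then have pos: "0 < inn g g"
    using assms inn_nonneg inn_definite by force
  define c where "c = inn f g / inn g g"
  have "0 \<le> inn (f - c *\<^sub>R g) (f - c *\<^sub>R g)"
    using assms by (simp add: inn_nonneg)
  also have "\<dots> = inn f f - (inn f g)\<^sup>2 / inn g g"
    using assms pos inn_commute[of f g]
    by (simp add: inn_simps c_def power2_eq_square)
  finally have "(inn f g)\<^sup>2 \<le> inn f f * inn g g"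
    using pos by (simp add: field_simps)
  then show ?thesis
    by (metis nrm_def real_sqrt_abs real_sqrt_le_iff real_sqrt_mult)
qed (use assms in simp)

lemma nrm_triangle:
  assumes "f \<in> V" "g \<in> V"
  shows "nrm (f + g) \<le> nrm f + nrm g"
proof (rule power2_le_imp_le)
  have "(nrm (f + g))\<^sup>2 = (nrm f)\<^sup>2 + 2 * inn f g + (nrm g)\<^sup>2"
    using assms inn_commute[of f g] by (simp add: nrm_sq inn_simps)
  also have "\<dots> \<le> (nrm f + nrm g)\<^sup>2"
    using cauchy_schwarz[OF assms] by (simp add: power2_eq_square algebra_simps)
  finally show "(nrm (f + g))\<^sup>2 \<le> (nrm f + nrm g)\<^sup>2" .
qed (use assms in simp)

lemma nrm_triangle_diff:
  assumes "f \<in> V" "g \<in> V" "h \<in> V"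
  shows "nrm (f - h) \<le> nrm (f - g) + nrm (g - h)"
  using nrm_triangle[of "f - g" "g - h"] assms by simp

lemma nrm_diff_ineq:
  assumes "f \<in> V" "g \<in> V"
  shows "\<bar>nrm f - nrm g\<bar> \<le> nrm (f - g)"
  using nrm_triangle[of "f - g" g] nrm_triangle[of "g - f" f] assms
    nrm_minus_commute[of f g] by simp

lemma complete:
  assumes "\<And>n::nat. u n \<in> V" "\<And>e. e > 0 \<Longrightarrow> \<exists>N. \<forall>m\<ge>N. \<forall>n\<ge>N. nrm (u m - u n) < e"
  shows "\<exists>f\<in>V. (\<lambda>n. nrm (u n - f)) \<longlonglongrightarrow> 0"
  using cauchy_converges[of u] assms unfolding nrm_def by blast

text \<open>
  Weak convergence of a norm convergent sequence.
\<close>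

lemma inn_tendsto:
  assumes "\<And>n. u n \<in> V" "f \<in> V" "g \<in> V" "(\<lambda>n. nrm (u n - f)) \<longlonglongrightarrow> 0"
  shows "(\<lambda>n. inn (u n) g) \<longlonglongrightarrow> inn f g"
proof -
  have "(\<lambda>n. inn (u n) g - inn f g) \<longlonglongrightarrow> 0"
  proof (rule Lim_null_comparison)
    show "\<forall>\<^sub>F n in sequentially. norm (inn (u n) g - inn f g) \<le> nrm (u n - f) * nrm g"
      using assms cauchy_schwarz[of "u _ - f" g] by (simp add: inn_diff_left)
    show "(\<lambda>n. nrm (u n - f) * nrm g) \<longlonglongrightarrow> 0"
      using tendsto_mult_left_zero[OF assms(4)] by simp
  qed
  then show ?thesis using LIM_zero_iff by blast
qed

section \<open>Bounded, symmetric and invertible operators\<close>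

definition bop :: "('v \<Rightarrow> 'v) \<Rightarrow> bool" where
  "bop T \<longleftrightarrow> (\<forall>f\<in>V. T f \<in> V) \<and> (\<forall>f\<in>V. \<forall>g\<in>V. T (f + g) = T f + T g) \<and>
     (\<forall>c. \<forall>f\<in>V. T (c *\<^sub>R f) = c *\<^sub>R T f) \<and> (\<exists>C. \<forall>f\<in>V. nrm (T f) \<le> C * nrm f)"

definition symm :: "('v \<Rightarrow> 'v) \<Rightarrow> bool" where
  "symm T \<longleftrightarrow> (\<forall>f\<in>V. \<forall>g\<in>V. inn (T f) g = inn f (T g))"

definition invertible_op :: "('v \<Rightarrow> 'v) \<Rightarrow> bool" where
  "invertible_op T \<longleftrightarrow> (\<exists>S. bop S \<and> (\<forall>f\<in>V. S (T f) = f \<and> T (S f) = f))"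

definition spec :: "('v \<Rightarrow> 'v) \<Rightarrow> real set" where
  "spec T = {t. \<not> invertible_op (\<lambda>f. T f - t *\<^sub>R f)}"

lemma bop_mem: "\<lbrakk>bop T; f \<in> V\<rbrakk> \<Longrightarrow> T f \<in> V"
  and bop_add: "\<lbrakk>bop T; f \<in> V; g \<in> V\<rbrakk> \<Longrightarrow> T (f + g) = T f + T g"
  and bop_scale: "\<lbrakk>bop T; f \<in> V\<rbrakk> \<Longrightarrow> T (c *\<^sub>R f) = c *\<^sub>R T f"
  by (auto simp: bop_def)

lemma bop_bound:
  assumes "bop T"
  obtains C where "C > 0" "\<And>f. f \<in> V \<Longrightarrow> nrm (T f) \<le> C * nrm f"
proof -
  obtain C where C: "\<forall>f\<in>V. nrm (T f) \<le> C * nrm f"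
    using assms bop_def by blast
  have "nrm (T f) \<le> (\<bar>C\<bar> + 1) * nrm f" if "f \<in> V" for f
  proof -
    have "C * nrm f \<le> (\<bar>C\<bar> + 1) * nrm f"
      by (rule mult_right_mono) (use that in auto)
    then show ?thesis using C that by force
  qed
  then show ?thesis using that[of "\<bar>C\<bar> + 1"] by force
qed

lemma bopI:
  assumes "\<And>f. f \<in> V \<Longrightarrow> T f \<in> V"
    and "\<And>f g. \<lbrakk>f \<in> V; g \<in> V\<rbrakk> \<Longrightarrow> T (f + g) = T f + T g"
    and "\<And>c f. f \<in> V \<Longrightarrow> T (c *\<^sub>R f) = c *\<^sub>R T f"
    and "\<And>f. f \<in> V \<Longrightarrow> nrm (T f) \<le> C * nrm f"
  shows "bop T"
  using assms unfolding bop_def by blast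

lemma bop_diff:
  assumes "bop T" "f \<in> V" "g \<in> V"
  shows "T (f - g) = T f - T g"
  using bop_add[of T f "(-1) *\<^sub>R g"] bop_scale[of T g "-1"] assms by simp

lemma bop_comp:
  assumes "bop S" "bop T"
  shows "bop (\<lambda>f. S (T f))"
proof -
  obtain C D where C: "C > 0" "\<And>f. f \<in> V \<Longrightarrow> nrm (S f) \<le> C * nrm f"
    and D: "D > 0" "\<And>f. f \<in> V \<Longrightarrow> nrm (T f) \<le> D * nrm f"
    using assms bop_bound by metis
  have "nrm (S (T f)) \<le> C * D * nrm f" if "f \<in> V" for f
    using order_trans[OF C(2)[OF bop_mem[OF assms(2) that]] mult_left_mono[OF D(2)[OF that], of C]] C(1)
    by (simp add: mult.assoc)
  then show ?thesis
    using assms by (intro bopI[where C = "C * D"]) (auto simp: bop_mem bop_add bop_scale)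
qed

lemma bop_lincomb:
  assumes "bop S" "bop T"
  shows "bop (\<lambda>f. a *\<^sub>R S f + b *\<^sub>R T f)"
proof -
  obtain C D where C: "C > 0" "\<And>f. f \<in> V \<Longrightarrow> nrm (S f) \<le> C * nrm f"
    and D: "D > 0" "\<And>f. f \<in> V \<Longrightarrow> nrm (T f) \<le> D * nrm f"
    using assms bop_bound by metis
  have "nrm (a *\<^sub>R S f + b *\<^sub>R T f) \<le> (\<bar>a\<bar> * C + \<bar>b\<bar> * D) * nrm f" if "f \<in> V" for f
  proof -
    have "nrm (a *\<^sub>R S f + b *\<^sub>R T f) \<le> \<bar>a\<bar> * nrm (S f) + \<bar>b\<bar> * nrm (T f)"
      using nrm_triangle[of "a *\<^sub>R S f" "b *\<^sub>R T f"] that assms by (simp add: nrm_scale bop_mem)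
    also have "\<dots> \<le> \<bar>a\<bar> * (C * nrm f) + \<bar>b\<bar> * (D * nrm f)"
      using C D that by (intro add_mono mult_left_mono) auto
    finally show ?thesis by (simp add: algebra_simps)
  qed
  then show ?thesis
    using assms
    by (intro bopI[where C = "\<bar>a\<bar> * C + \<bar>b\<bar> * D"])
      (auto simp: bop_mem bop_add bop_scale algebra_simps)
qed

lemma bop_ident: "bop (\<lambda>f. f)"
  by (rule bopI[where C = 1]) auto

lemma bop_shift: "bop T \<Longrightarrow> bop (\<lambda>f. T f - t *\<^sub>R f)"
  using bop_lincomb[of T "\<lambda>f. f" 1 "- t"] bop_ident by simp

lemma symm_shift: "\<lbrakk>bop T; symm T\<rbrakk> \<Longrightarrow> symm (\<lambda>f. T f - t *\<^sub>R f)"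
  by (auto simp: symm_def inn_simps bop_mem)

section \<open>Minimising a quadratic functional\<close>

text \<open>
  The solution is the minimiser of \<open>J(f) = \<langle>S f, f\<rangle> - 2 \<phi>(f)\<close>. Coercivity bounds \<open>J\<close> from below, and
  with the parallelogram law it makes every minimising sequence a Cauchy sequence; the vanishing of
  the derivative of \<open>J\<close> at the limit is the required equation.
\<close>

lemma symmetric_lax_milgram:
  assumes S: "bop S" "symm S" and c: "c > 0" "\<And>f. f \<in> V \<Longrightarrow> c * (nrm f)\<^sup>2 \<le> inn (S f) f"
    and \<phi>: "\<And>f g. \<lbrakk>f \<in> V; g \<in> V\<rbrakk> \<Longrightarrow> \<phi> (f + g) = \<phi> f + \<phi> g"
      "\<And>a f. f \<in> V \<Longrightarrow> \<phi> (a *\<^sub>R f) = a * \<phi> f"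
      "\<And>f. f \<in> V \<Longrightarrow> \<bar>\<phi> f\<bar> \<le> C * nrm f"
  shows "\<exists>u\<in>V. \<forall>h\<in>V. inn (S u) h = \<phi> h"
proof -
  define J where "J f = inn (S f) f - 2 * \<phi> f" for f
  define m where "m = Inf (J ` V)"
  note mem = bop_mem[OF S(1)]
  have Scomm: "inn (S g) f = inn (S f) g" if "f \<in> V" "g \<in> V" for f g
    using S(2) that mem inn_commute unfolding symm_def by metis
  have expand: "J (u + t *\<^sub>R h) = J u + 2 * t * (inn (S u) h - \<phi> h) + t\<^sup>2 * inn (S h) h"
    if "u \<in> V" "h \<in> V" for u h t
    using that Scomm[of u h] \<phi>(1)[of u "t *\<^sub>R h"] \<phi>(2)
    by (simp add: J_def bop_add[OF S(1)] bop_scale[OF S(1)] mem inn_simps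
        algebra_simps power2_eq_square)
  have lower: "- (C\<^sup>2 / c) \<le> J f" if "f \<in> V" for f
  proof -
    have "0 \<le> (c * nrm f - C)\<^sup>2 / c"
      using c by simp
    also have "\<dots> = c * (nrm f)\<^sup>2 - 2 * (C * nrm f) + C\<^sup>2 / c"
      using c by (simp add: power2_eq_square field_simps)
    also have "\<dots> \<le> J f + C\<^sup>2 / c"
      using c(2)[OF that] \<phi>(3)[OF that] unfolding J_def by linarith
    finally show ?thesis by simp
  qed
  then have bdd: "bdd_below (J ` V)"
    by (auto intro!: bdd_belowI)
  then have m_le: "m \<le> J f" if "f \<in> V" for f
    unfolding m_def using that by (intro cInf_lower) auto
  have "\<exists>f\<in>V. J f < m + 1 / real (Suc n)" for n
  proof -
    have "Inf (J ` V) < m + 1 / real (Suc n)"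
      by (simp add: m_def)
    then show ?thesis
      using cInf_lessD[of "J ` V"] zero_mem by blast
  qed
  then obtain u where u: "\<And>n. u n \<in> V" "\<And>n. J (u n) < m + 1 / real (Suc n)"
    by metis
  \<comment> \<open>The parallelogram law for \<open>J\<close>, with \<open>w\<close> the midpoint of \<open>f\<close> and \<open>g\<close>: two points where
    \<open>J\<close> is almost minimal are close to each other.\<close>
  have gap: "c * (nrm (f - g))\<^sup>2 \<le> 2 * (J f - m) + 2 * (J g - m)" if "f \<in> V" "g \<in> V" for f g
  proof -
    define h where "h = (1/2) *\<^sub>R (f - g)"
    define w where "w = (1/2) *\<^sub>R (f + g)"
    have hw: "h \<in> V" "w \<in> V" using that by (auto simp: h_def w_def)
    have "f = w + 1 *\<^sub>R h" "g = w + (-1) *\<^sub>R h"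
      using scaleR_half_double[of f] scaleR_half_double[of g]
      by (simp_all add: h_def w_def scaleR_diff_right scaleR_add_right flip: scaleR_add_left)
    then have "J f + J g = 2 * J w + 2 * inn (S h) h"
      using expand[OF hw(2,1), of 1] expand[OF hw(2,1), of "-1"] by simp
    moreover have "c * (nrm (f - g))\<^sup>2 = 4 * (c * (nrm h)\<^sup>2)"
      using that by (simp add: h_def nrm_scale power_mult_distrib power2_eq_square)
    ultimately show ?thesis
      using c(2)[OF hw(1)] m_le[OF hw(2)] by argo
  qed
  have "\<exists>N. \<forall>k\<ge>N. \<forall>n\<ge>N. nrm (u k - u n) < e" if "e > 0" for e
  proof -
    obtain N where N: "1 / real (Suc N) < c * e\<^sup>2 / 4"
      using c \<open>e > 0\<close> by (meson nat_approx_posE divide_pos_pos mult_pos_pos zero_less_numeral zero_less_power)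
    have "nrm (u k - u n) < e" if "k \<ge> N" "n \<ge> N" for k n
    proof (rule power2_less_imp_less)
      have "1 / real (Suc k) \<le> 1 / real (Suc N)" "1 / real (Suc n) \<le> 1 / real (Suc N)"
        using that by (auto intro!: divide_left_mono)
      then have "c * (nrm (u k - u n))\<^sup>2 < c * e\<^sup>2"
        using gap[OF u(1)[of k] u(1)[of n]] u(2)[of k] u(2)[of n] N by argo
      then show "(nrm (u k - u n))\<^sup>2 < e\<^sup>2"
        using c by simp
    qed (use \<open>e > 0\<close> in simp)
    then show ?thesis by blast
  qed
  then obtain f where f: "f \<in> V" "(\<lambda>n. nrm (u n - f)) \<longlonglongrightarrow> 0"
    using complete[of u] u(1) by blast
  have "inn (S f) h = \<phi> h" if h: "h \<in> V" for h
  proof -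
    have "(\<lambda>n. inn (u n) (S h)) \<longlonglongrightarrow> inn f (S h)"
      using inn_tendsto[OF u(1) f(1) mem[OF h] f(2)] .
    then have lim: "(\<lambda>n. inn (S (u n)) h) \<longlonglongrightarrow> inn (S f) h"
      using S(2) u(1) f(1) h unfolding symm_def by simp
    \<comment> \<open>The minimality of \<open>J\<close> is used at \<open>u n\<close>, up to the error \<open>1 / Suc n\<close>, and only the resulting
      inequality is taken to the limit: this avoids continuity of \<open>J\<close>.\<close>
    have "0 \<le> 2 * t * (inn (S f) h - \<phi> h) + t\<^sup>2 * inn (S h) h" for t
    proof (rule LIMSEQ_le_const)
      have "(\<lambda>n. 1 / real (Suc n)) \<longlonglongrightarrow> 0"
        using LIMSEQ_inverse_real_of_nat by (simp add: divide_inverse)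
      then have "(\<lambda>n. 2 * t * (inn (S (u n)) h - \<phi> h) + t\<^sup>2 * inn (S h) h + 1 / real (Suc n))
          \<longlonglongrightarrow> 2 * t * (inn (S f) h - \<phi> h) + t\<^sup>2 * inn (S h) h + 0"
        by (rule tendsto_add[OF tendsto_add[OF tendsto_mult[OF tendsto_const tendsto_diff[OF lim tendsto_const]] tendsto_const]])
      then show "(\<lambda>n. 2 * t * (inn (S (u n)) h - \<phi> h) + t\<^sup>2 * inn (S h) h + 1 / real (Suc n))
          \<longlonglongrightarrow> 2 * t * (inn (S f) h - \<phi> h) + t\<^sup>2 * inn (S h) h"
        by simp
      have "0 \<le> 2 * t * (inn (S (u n)) h - \<phi> h) + t\<^sup>2 * inn (S h) h + 1 / real (Suc n)" for n
      proof -
        have "m \<le> J (u n + t *\<^sub>R h)"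
          using u(1) h by (intro m_le) auto
        then show ?thesis
          unfolding expand[OF u(1) h] using u(2)[of n] by argo
      qed
      then show "\<exists>N. \<forall>n\<ge>N. 0 \<le> 2 * t * (inn (S (u n)) h - \<phi> h) + t\<^sup>2 * inn (S h) h + 1 / real (Suc n)"
        by (intro exI[of _ 0] allI impI)
    qed
    moreover have "0 \<le> inn (S h) h"
      using order_trans[OF _ c(2)[OF h], of 0] c(1) by simp
    ultimately have "inn (S f) h - \<phi> h = 0"
      by (intro quadratic_nonneg_imp_zero)
    then show ?thesis by simp
  qed
  then show ?thesis using f(1) by blast
qed

lemma inn_eqI:
  assumes "f \<in> V" "g \<in> V" "\<And>h. h \<in> V \<Longrightarrow> inn f h = inn g h"
  shows "f = g"
  using inn_definite[of "f - g"] assms by (simp add: inn_simps)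

text \<open>
  \<open>S\<^sup>2\<close> is coercive, because \<open>\<langle>S\<^sup>2 f, f\<rangle> = \<parallel>S f\<parallel>\<^sup>2\<close>; hence it is onto, and \<open>S\<close> along with it. The lower
  bound provides injectivity and the bound of the inverse.
\<close>

lemma symm_bounded_below_invertible:
  assumes S: "bop S" "symm S" and c: "c > 0" "\<And>f. f \<in> V \<Longrightarrow> c * nrm f \<le> nrm (S f)"
  shows "invertible_op S"
proof -
  note mem = bop_mem[OF S(1)]
  have inj: "f = g" if "f \<in> V" "g \<in> V" "S f = S g" for f g
  proof -
    have "nrm (f - g) \<le> 0"
      using c(2)[of "f - g"] that c(1) by (simp add: bop_diff[OF S(1)] mult_le_0_iff)
    then have "nrm (f - g) = 0"
      using that by (intro antisym) auto
    then show ?thesis using that by simp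
  qed
  have surj: "\<exists>f\<in>V. S f = g" if g: "g \<in> V" for g
  proof -
    have "\<exists>u\<in>V. \<forall>h\<in>V. inn (S (S u)) h = inn g h"
    proof (rule symmetric_lax_milgram[where c = "c\<^sup>2" and C = "nrm g"])
      show "bop (\<lambda>u. S (S u))" using bop_comp[OF S(1) S(1)] .
      show "symm (\<lambda>u. S (S u))" using S(2) mem by (simp add: symm_def)
      show "c\<^sup>2 * (nrm f)\<^sup>2 \<le> inn (S (S f)) f" if "f \<in> V" for f
      proof -
        have "(c * nrm f)\<^sup>2 \<le> (nrm (S f))\<^sup>2"
          using c that by (intro power_mono) auto
        then show ?thesis
          using S(2) that mem by (simp add: symm_def nrm_sq power_mult_distrib)
      qed
      show "inn g (f + h) = inn g f + inn g h" if "f \<in> V" "h \<in> V" for f h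
        using that g by (rule inn_add_right)
      show "inn g (a *\<^sub>R f) = a * inn g f" if "f \<in> V" for a f
        using that g by (rule inn_scale_right)
      show "\<bar>inn g f\<bar> \<le> nrm g * nrm f" if "f \<in> V" for f
        using g that by (rule cauchy_schwarz)
    qed (use c in simp)
    then obtain u where u: "u \<in> V" "\<And>h. h \<in> V \<Longrightarrow> inn (S (S u)) h = inn g h"
      by blast
    have "S (S u) = g"
      using u mem g by (intro inn_eqI) auto
    then show ?thesis
      using mem[OF u(1)] by blast
  qed
  define R where "R g = (SOME f. f \<in> V \<and> S f = g)" for g
  have R: "R g \<in> V" "S (R g) = g" if "g \<in> V" for g
    using someI_ex[of "\<lambda>f. f \<in> V \<and> S f = g"] surj[OF that] unfolding R_def by auto
  have "bop R"
  proof (rule bopI[where C = "1 / c"])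
    show "R (f + g) = R f + R g" if "f \<in> V" "g \<in> V" for f g
      by (rule inj) (simp_all add: that R bop_add[OF S(1)])
    show "R (a *\<^sub>R f) = a *\<^sub>R R f" if "f \<in> V" for a f
      by (rule inj) (simp_all add: that R bop_scale[OF S(1)])
    show "nrm (R f) \<le> 1 / c * nrm f" if "f \<in> V" for f
    proof -
      have "c * nrm (R f) \<le> nrm f"
        using c(2)[OF R(1)[OF that]] by (simp add: R(2)[OF that])
      then show ?thesis
        using c(1) by (simp add: field_simps)
    qed
    show "R f \<in> V" if "f \<in> V" for f
      using that by (rule R(1))
  qed
  moreover have "R (S f) = f" if "f \<in> V" for f
    by (rule inj) (simp_all add: that R mem)
  ultimately show ?thesis
    using R unfolding invertible_op_def by blast
qed

section \<open>Polynomials of an operator\<close>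

definition papp :: "real poly \<Rightarrow> ('v \<Rightarrow> 'v) \<Rightarrow> 'v \<Rightarrow> 'v" where
  "papp p T f = (\<Sum>i\<le>degree p. coeff p i *\<^sub>R (T ^^ i) f)"

lemma papp_0 [simp]: "papp 0 T f = 0"
  by (simp add: papp_def)

text \<open>
  The Horner form, on which all inductions over polynomials below rest.
\<close>

lemma papp_pCons: "papp (pCons a p) T f = a *\<^sub>R f + papp p T (T f)"
proof (cases "p = 0")
  case False
  then show ?thesis
    by (simp add: papp_def sum.atMost_Suc_shift funpow_swap1 del: sum.atMost_Suc)
qed (simp add: papp_def)

lemma papp_add: "papp (p + q) T f = papp p T f + papp q T f"
proof (induction p q arbitrary: f rule: poly_induct2)
  case (pCons a p b q)
  then show ?case by (simp add: papp_pCons algebra_simps)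
qed simp

lemma papp_smult: "papp (smult c p) T f = c *\<^sub>R papp p T f"
  by (induction p arbitrary: f) (simp_all add: papp_pCons algebra_simps)

lemma papp_diff: "papp (p - q) T f = papp p T f - papp q T f"
  using papp_add[of p "smult (-1) q" T f] by (simp only: papp_smult) simp

lemma papp_mem: "\<lbrakk>bop T; f \<in> V\<rbrakk> \<Longrightarrow> papp p T f \<in> V"
  by (induction p arbitrary: f) (simp_all add: papp_pCons bop_mem)

lemma papp_commute: "\<lbrakk>bop T; f \<in> V\<rbrakk> \<Longrightarrow> papp p T (T f) = T (papp p T f)"
proof (induction p arbitrary: f)
  case 0
  then show ?case using bop_scale[of T 0 0] by simp
next
  case (pCons a p)
  then show ?case by (simp add: papp_pCons bop_add bop_scale papp_mem bop_mem)
qed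

lemma papp_mult:
  assumes "bop T" "f \<in> V"
  shows "papp (p * q) T f = papp p T (papp q T f)"
  using assms
proof (induction p arbitrary: f)
  case (pCons a p)
  then show ?case
    by (simp add: papp_add papp_smult papp_pCons papp_commute papp_mem bop_mem)
qed simp

lemma bop_papp: "bop T \<Longrightarrow> bop (papp p T)"
proof (induction p)
  case 0
  show ?case by (rule bopI[where C = 0]) auto
next
  case (pCons a p)
  have "papp (pCons a p) T = (\<lambda>f. a *\<^sub>R f + 1 *\<^sub>R papp p T (T f))"
    by (simp add: fun_eq_iff papp_pCons)
  then show ?case
    by (simp only: bop_lincomb[OF bop_ident bop_comp[OF pCons.IH[OF pCons.prems] pCons.prems]])
qed

lemma symm_papp: "\<lbrakk>bop T; symm T\<rbrakk> \<Longrightarrow> symm (papp p T)"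
proof (induction p)
  case (pCons a p)
  have "inn (papp p T (T f)) g = inn f (papp p T (T g))" if "f \<in> V" "g \<in> V" for f g
    using pCons that by (simp add: symm_def bop_mem papp_commute papp_mem)
  then show ?case
    using pCons by (simp add: symm_def papp_pCons inn_simps papp_mem bop_mem)
qed (simp add: symm_def)

lemma invertible_comp:
  assumes "invertible_op S" "invertible_op T" "bop S" "bop T"
  shows "invertible_op (\<lambda>f. S (T f))"
proof -
  obtain S' T' where S': "bop S'" "\<forall>f\<in>V. S' (S f) = f \<and> S (S' f) = f"
    and T': "bop T'" "\<forall>f\<in>V. T' (T f) = f \<and> T (T' f) = f"
    using assms(1,2) unfolding invertible_op_def by blast
  have "T' (S' (S (T f))) = f \<and> S (T (T' (S' f))) = f" if "f \<in> V" for f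
    using S'(2) T'(2) bop_mem[OF assms(4) that] bop_mem[OF S'(1) that] that by simp
  then show ?thesis
    using bop_comp[OF T'(1) S'(1)] unfolding invertible_op_def by blast
qed

lemma invertible_cong:
  assumes "invertible_op S" "\<And>f. f \<in> V \<Longrightarrow> S f = T f"
  shows "invertible_op T"
proof -
  obtain R where R: "bop R" "\<forall>f\<in>V. R (S f) = f \<and> S (R f) = f"
    using assms(1) unfolding invertible_op_def by blast
  have "R (T f) = f \<and> T (R f) = f" if "f \<in> V" for f
    using R(2) that by (simp flip: assms(2) add: bop_mem[OF R(1)])
  then show ?thesis
    using R(1) unfolding invertible_op_def by blast
qed

lemma invertible_bounded_below:
  assumes "invertible_op S" "bop S"
  obtains d where "d > 0" "\<And>f. f \<in> V \<Longrightarrow> d * nrm f \<le> nrm (S f)"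
proof -
  obtain R where R: "bop R" "\<forall>f\<in>V. R (S f) = f \<and> S (R f) = f"
    using assms(1) unfolding invertible_op_def by blast
  obtain C where C: "C > 0" "\<And>f. f \<in> V \<Longrightarrow> nrm (R f) \<le> C * nrm f"
    using bop_bound[OF R(1)] by metis
  have "1 / C * nrm f \<le> nrm (S f)" if "f \<in> V" for f
  proof -
    have "nrm f \<le> C * nrm (S f)"
      using C(2)[OF bop_mem[OF assms(2) that]] R(2) that by simp
    then show ?thesis
      using C(1) by (simp add: field_simps)
  qed
  then show ?thesis
    using that[of "1 / C"] C(1) by simp
qed

lemma coercive_bounded_below:
  assumes "bop S" "f \<in> V" "c * (nrm f)\<^sup>2 \<le> inn (S f) f"
  shows "c * nrm f \<le> nrm (S f)"
proof -
  have "inn (S f) f \<le> nrm (S f) * nrm f"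
    using cauchy_schwarz[OF bop_mem[OF assms(1,2)] assms(2)] by simp
  then have "(c * nrm f) * nrm f \<le> nrm (S f) * nrm f"
    using assms(3) by (simp add: power2_eq_square mult.assoc)
  then show ?thesis
    using nrm_nonneg[OF bop_mem[OF assms(1,2)]] nrm_nonneg[OF assms(2)]
    by (cases "nrm f = 0") auto
qed

lemma coercive_invertible:
  assumes "bop S" "symm S" "c > 0" "\<And>f. f \<in> V \<Longrightarrow> c * (nrm f)\<^sup>2 \<le> inn (S f) f"
  shows "invertible_op S"
  using symm_bounded_below_invertible[OF assms(1-3)] coercive_bounded_below[OF assms(1)] assms(4)
  by blast

text \<open>
  The operator is \<open>(T - a)\<^sup>2 + b\<^sup>2\<close>, whose quadratic form is at least that of \<open>b\<^sup>2\<close>.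
\<close>

lemma quadratic_invertible:
  assumes T: "bop T" "symm T" and b: "b \<noteq> 0"
  shows "invertible_op (papp [:a\<^sup>2 + b\<^sup>2, - 2 * a, 1:] T)"
proof (rule coercive_invertible)
  let ?q = "[:a\<^sup>2 + b\<^sup>2, - 2 * a, 1:]"
  show "bop (papp ?q T)" "symm (papp ?q T)"
    using T by (auto intro: bop_papp symm_papp)
  show "b\<^sup>2 > 0" using b by simp
  fix f assume f: "f \<in> V"
  have q: "papp ?q T f = T (T f) - (2 * a) *\<^sub>R T f + (a\<^sup>2 + b\<^sup>2) *\<^sub>R f"
    by (simp add: papp_pCons)
  have "inn (T (T f)) f = inn (T f) (T f)" "inn f (T f) = inn (T f) f"
    using T f bop_mem[OF T(1)] unfolding symm_def by auto
  then have "inn (papp ?q T f) f = (nrm (T f - a *\<^sub>R f))\<^sup>2 + b\<^sup>2 * (nrm f)\<^sup>2"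
    using f bop_mem[OF T(1)] unfolding q
    by (simp add: nrm_sq inn_simps) (simp add: algebra_simps power2_eq_square)
  then show "b\<^sup>2 * (nrm f)\<^sup>2 \<le> inn (papp ?q T f) f"
    by simp
qed

text \<open>
  Half of the spectral mapping theorem. By the fundamental theorem of algebra \<open>q\<close> is a product of
  factors \<open>t - z\<close> with real \<open>z\<close>, which is not in the spectrum of \<open>T\<close> as \<open>q(z) = 0\<close>, and of quadratic
  factors without real zeros. All of them give invertible operators.
\<close>

lemma papp_invertible:
  assumes "bop T" "symm T" "q \<noteq> 0" "\<And>t. t \<in> spec T \<Longrightarrow> poly q t \<noteq> 0"
  shows "invertible_op (papp q T)"
  using assms(3,4)
proof (induction "degree q" arbitrary: q rule: less_induct)
  case less
  have factor: "invertible_op (papp q T)"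
    if q: "q = d * p" and d: "degree d > 0" "invertible_op (papp d T)" for d p
  proof -
    have "p \<noteq> 0" "d \<noteq> 0" using less.prems(1) q by auto
    then have "degree p < degree q"
      using q d(1) by (simp add: degree_mult_eq)
    moreover have "poly p t \<noteq> 0" if "t \<in> spec T" for t
      using less.prems(2)[OF that] by (simp add: q)
    ultimately have "invertible_op (papp p T)"
      using less.hyps \<open>p \<noteq> 0\<close> by blast
    then have "invertible_op (\<lambda>f. papp d T (papp p T f))"
      using invertible_comp[OF d(2) _ bop_papp bop_papp] assms(1) by blast
    then show ?thesis
      by (rule invertible_cong) (simp add: q papp_mult[OF assms(1)])
  qed
  show ?case
  proof (cases "degree q = 0")
    case True
    then obtain c where "q = [:c:]" using degree_eq_zeroE by blast
    moreover then have "c \<noteq> 0" using less.prems(1) by auto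
    ultimately show ?thesis
      using bop_lincomb[OF bop_ident bop_ident, of "1/c" 0]
      unfolding invertible_op_def
      by (intro exI[of _ "\<lambda>f. (1/c) *\<^sub>R f"]) (auto simp: papp_pCons)
  next
    case False
    define qc where "qc = map_poly complex_of_real q"
    have "degree qc \<noteq> 0" using False by (simp add: qc_def degree_map_poly)
    then obtain z where z: "poly qc z = 0"
      using fundamental_theorem_of_algebra constant_degree by metis
    show ?thesis
    proof (cases "Im z = 0")
      case True
      then have "poly qc (complex_of_real (Re z)) = 0"
        using z by (metis complex_is_Real_iff of_real_Re)
      then have root: "poly q (Re z) = 0"
        by (simp add: qc_def poly_map_of_real_of_real)
      then obtain p where p: "q = [:- Re z, 1:] * p"
        using poly_eq_0_iff_dvd by (metis dvdE)
      have "Re z \<notin> spec T" using less.prems(2) root by blast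
      then have "invertible_op (\<lambda>f. T f - Re z *\<^sub>R f)"
        by (simp add: spec_def)
      then have "invertible_op (papp [:- Re z, 1:] T)"
        by (rule invertible_cong) (simp add: papp_pCons)
      then show ?thesis using factor[OF p] by simp
    next
      case False
      then obtain p where p: "q = [:(Re z)\<^sup>2 + (Im z)\<^sup>2, - 2 * Re z, 1:] * p"
        using nonreal_root_quadratic_dvd[of q z] z by (auto simp: qc_def dvd_def)
      show ?thesis
        by (rule factor[OF p _ quadratic_invertible[OF assms(1,2) False]]) simp
    qed
  qed
qed

section \<open>The norm of a polynomial of a symmetric operator\<close>

text \<open>
  The operator norm, described by its two characteristic properties.
\<close>

lemma best_bound:
  assumes "bop S"
  obtains m where "m \<ge> 0" "\<And>f. f \<in> V \<Longrightarrow> nrm (S f) \<le> m * nrm f"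
    "\<And>C. \<lbrakk>C \<ge> 0; \<And>f. f \<in> V \<Longrightarrow> nrm (S f) \<le> C * nrm f\<rbrakk> \<Longrightarrow> m \<le> C"
proof -
  define B where "B = {C. C \<ge> 0 \<and> (\<forall>f\<in>V. nrm (S f) \<le> C * nrm f)}"
  obtain C0 where C0: "C0 > 0" "\<And>f. f \<in> V \<Longrightarrow> nrm (S f) \<le> C0 * nrm f"
    using bop_bound[OF assms] by blast
  then have "C0 \<in> B" by (simp add: B_def)
  then have ne: "B \<noteq> {}" by blast
  have bdd: "bdd_below B" by (rule bdd_belowI[of _ 0]) (simp add: B_def)
  have "nrm (S f) \<le> Inf B * nrm f" if f: "f \<in> V" for f
  proof (cases "nrm f = 0")
    case True
    then show ?thesis using C0(2)[OF f] by simp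
  next
    case False
    then have pos: "nrm f > 0" using nrm_nonneg[OF f] by simp
    have "nrm (S f) / nrm f \<le> Inf B"
    proof (rule cInf_greatest[OF ne])
      fix C assume "C \<in> B"
      then show "nrm (S f) / nrm f \<le> C"
        using f pos by (simp add: B_def field_simps)
    qed
    then show ?thesis using pos by (simp add: field_simps)
  qed
  moreover have "0 \<le> Inf B"
    using ne by (intro cInf_greatest) (auto simp: B_def)
  moreover have "Inf B \<le> C" if "C \<ge> 0" "\<And>f. f \<in> V \<Longrightarrow> nrm (S f) \<le> C * nrm f" for C
    using that bdd by (intro cInf_lower) (auto simp: B_def)
  ultimately show ?thesis using that[of "Inf B"] by blast
qed

text \<open>
  A symmetric operator almost attains its norm \<open>m\<close> at unit vectors \<open>f\<close>, and then
  \<open>\<parallel>S\<^sup>2 f - m\<^sup>2 f\<parallel>\<^sup>2 = \<parallel>S\<^sup>2 f\<parallel>\<^sup>2 - 2 m\<^sup>2 \<parallel>S f\<parallel>\<^sup>2 + m\<^sup>4 \<le> 2 m\<^sup>2 (m\<^sup>2 - \<parallel>S f\<parallel>\<^sup>2)\<close> is almost zero, so that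
  \<open>S\<^sup>2 - m\<^sup>2\<close> is not bounded below. The proof argues backwards: a lower bound \<open>d\<close> would
  allow a smaller norm than \<open>m\<close>.
\<close>

lemma norm_square_not_invertible:
  assumes S: "bop S" "symm S" and ne: "\<exists>f\<in>V. f \<noteq> 0"
  obtains m where "m \<ge> 0" "\<And>f. f \<in> V \<Longrightarrow> nrm (S f) \<le> m * nrm f"
    "\<not> invertible_op (\<lambda>f. S (S f) - m\<^sup>2 *\<^sub>R f)"
proof -
  note mem = bop_mem[OF S(1)]
  obtain m where m: "m \<ge> 0" "\<And>f. f \<in> V \<Longrightarrow> nrm (S f) \<le> m * nrm f"
    "\<And>C. \<lbrakk>C \<ge> 0; \<And>f. f \<in> V \<Longrightarrow> nrm (S f) \<le> C * nrm f\<rbrakk> \<Longrightarrow> m \<le> C"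
    using best_bound[OF S(1)] by blast
  have "\<not> invertible_op (\<lambda>f. S (S f) - m\<^sup>2 *\<^sub>R f)"
  proof
    assume "invertible_op (\<lambda>f. S (S f) - m\<^sup>2 *\<^sub>R f)"
    then obtain d where d: "d > 0" "\<And>f. f \<in> V \<Longrightarrow> d * nrm f \<le> nrm (S (S f) - m\<^sup>2 *\<^sub>R f)"
      using invertible_bounded_below[OF _ bop_shift[OF bop_comp[OF S(1) S(1)]]] by blast
    have key: "d\<^sup>2 * (nrm f)\<^sup>2 + 2 * m\<^sup>2 * (nrm (S f))\<^sup>2 \<le> 2 * m ^ 4 * (nrm f)\<^sup>2"
      if f: "f \<in> V" for f
    proof -
      have SSf: "nrm (S (S f)) \<le> m * (m * nrm f)"
        using order_trans[OF m(2)[OF mem[OF f]] mult_left_mono[OF m(2)[OF f] m(1)]] .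
      have "(d * nrm f)\<^sup>2 \<le> (nrm (S (S f) - m\<^sup>2 *\<^sub>R f))\<^sup>2"
        using d f by (intro power_mono) auto
      also have "\<dots> = (nrm (S (S f)))\<^sup>2 - 2 * m\<^sup>2 * (nrm (S f))\<^sup>2 + m ^ 4 * (nrm f)\<^sup>2"
      proof -
        have "inn (S (S f)) f = inn (S f) (S f)" "inn f (S (S f)) = inn (S f) (S f)"
          using S(2) f mem unfolding symm_def by auto
        then show ?thesis
          using f mem by (simp add: nrm_sq inn_simps)
            (simp add: power2_eq_square power4_eq_xxxx algebra_simps)
      qed
      also have "(nrm (S (S f)))\<^sup>2 \<le> (m * (m * nrm f))\<^sup>2"
        using f mem SSf by (intro power_mono nrm_nonneg) auto
      finally show ?thesis
        by (simp add: power_mult_distrib power2_eq_square power4_eq_xxxx algebra_simps)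
    qed
    show False
    proof (cases "m = 0")
      case True
      obtain f where "f \<in> V" "f \<noteq> 0" using ne by blast
      then show False using key[of f] d(1) True by (simp add: mult_le_0_iff)
    next
      case False
      \<comment> \<open>The inequality \<open>key\<close> solved for \<open>\<parallel>S f\<parallel>\<^sup>2\<close>: a bound for the square of the norm below \<open>m\<^sup>2\<close>.\<close>
      define k where "k = m\<^sup>2 - d\<^sup>2 / (2 * m\<^sup>2)"
      have le: "(nrm (S f))\<^sup>2 \<le> k * (nrm f)\<^sup>2" if "f \<in> V" for f
      proof -
        have "2 * m\<^sup>2 * k = 2 * m ^ 4 - d\<^sup>2"
          using False by (simp add: k_def right_diff_distrib power2_eq_square power4_eq_xxxx)
        then have "2 * m\<^sup>2 * (k * (nrm f)\<^sup>2) = (2 * m ^ 4 - d\<^sup>2) * (nrm f)\<^sup>2"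
          by (simp add: mult.assoc [symmetric])
        then have "2 * m\<^sup>2 * (nrm (S f))\<^sup>2 \<le> 2 * m\<^sup>2 * (k * (nrm f)\<^sup>2)"
          using key[OF that] by (simp add: left_diff_distrib)
        then show ?thesis
          using False by (simp add: mult_le_cancel_left_pos)
      qed
      obtain f where "f \<in> V" "f \<noteq> 0" using ne by blast
      then have "0 \<le> k"
        using order_trans[OF zero_le_power2 le[of f]] by (simp add: zero_le_mult_iff)
      have "nrm (S f) \<le> sqrt k * nrm f" if "f \<in> V" for f
        using real_sqrt_le_mono[OF le[OF that]] that mem by (simp add: real_sqrt_mult)
      then have "m \<le> sqrt k"
        using m(3) \<open>0 \<le> k\<close> by simp
      then have "m\<^sup>2 \<le> k"
        using power_mono[of m "sqrt k" 2] m(1) \<open>0 \<le> k\<close> by simp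
      then show False
        using d(1) False by (simp add: k_def field_simps mult_le_0_iff)
    qed
  qed
  then show ?thesis using that m(1,2) by blast
qed

lemma spec_nonempty:
  assumes T: "bop T" "symm T" and ne: "\<exists>f\<in>V. f \<noteq> 0"
  shows "spec T \<noteq> {}"
proof
  assume empty: "spec T = {}"
  obtain m where m: "\<not> invertible_op (\<lambda>f. T (T f) - m\<^sup>2 *\<^sub>R f)"
    using norm_square_not_invertible[OF assms] by blast
  have "invertible_op (papp [:- m\<^sup>2, 0, 1:] T)"
    using papp_invertible[OF T, of "[:- m\<^sup>2, 0, 1:]"] empty by simp
  then show False
    using m invertible_cong[of "papp [:- m\<^sup>2, 0, 1:] T"] by (simp add: papp_pCons)
qed

text \<open>
  With \<open>m\<close> the norm of \<open>p(T)\<close>, the operator \<open>p(T)\<^sup>2 - m\<^sup>2\<close> is not invertible. Hence the polynomial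
  \<open>p\<^sup>2 - m\<^sup>2\<close> vanishes at a point of the spectrum, where \<open>\<bar>p\<bar>\<close> equals \<open>m\<close>.
\<close>

lemma papp_norm_bound:
  assumes T: "bop T" "symm T" and ne: "\<exists>f\<in>V. f \<noteq> 0"
    and M: "\<And>t. t \<in> spec T \<Longrightarrow> \<bar>poly p t\<bar> \<le> M" and f: "f \<in> V"
  shows "nrm (papp p T f) \<le> M * nrm f"
proof -
  obtain m where m: "m \<ge> 0" "\<And>f. f \<in> V \<Longrightarrow> nrm (papp p T f) \<le> m * nrm f"
    "\<not> invertible_op (\<lambda>f. papp p T (papp p T f) - m\<^sup>2 *\<^sub>R f)"
    using norm_square_not_invertible[OF bop_papp[OF T(1), of p] symm_papp[OF T, of p] ne] by blast
  define q where "q = p * p - [:m\<^sup>2:]"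
  have "papp q T f = papp p T (papp p T f) - m\<^sup>2 *\<^sub>R f" if "f \<in> V" for f
    using that T by (simp add: q_def papp_diff papp_mult papp_pCons)
  then have "\<not> invertible_op (papp q T)"
    using m(3) invertible_cong[of "papp q T" "\<lambda>f. papp p T (papp p T f) - m\<^sup>2 *\<^sub>R f"] by auto
  then obtain t where t: "t \<in> spec T" "poly q t = 0"
    using papp_invertible[OF T, of q] spec_nonempty[OF T ne] by (cases "q = 0") auto
  then have "(poly p t)\<^sup>2 = m\<^sup>2"
    by (simp add: q_def power2_eq_square)
  then have "m \<le> M"
    using M[OF t(1)] m(1) by (metis abs_of_nonneg power2_eq_iff abs_minus_cancel)
  then show ?thesis
    using m(2)[OF f] mult_right_mono[OF _ nrm_nonneg[OF f], of m M] by simp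
qed

lemma spec_bounded:
  assumes T: "bop T" "symm T"
  obtains b where "\<And>t. t \<in> spec T \<Longrightarrow> \<bar>t\<bar> \<le> b"
proof -
  obtain C where C: "C > 0" "\<And>f. f \<in> V \<Longrightarrow> nrm (T f) \<le> C * nrm f"
    using bop_bound[OF T(1)] by blast
  have "invertible_op (\<lambda>f. T f - t *\<^sub>R f)" if t: "\<bar>t\<bar> > C" for t
  proof (rule symm_bounded_below_invertible[OF bop_shift[OF T(1)] symm_shift[OF T]])
    show "0 < \<bar>t\<bar> - C" using t by simp
    show "(\<bar>t\<bar> - C) * nrm f \<le> nrm (T f - t *\<^sub>R f)" if f: "f \<in> V" for f
      using nrm_diff_ineq[of "t *\<^sub>R f" "T f"] nrm_minus_commute[of "t *\<^sub>R f" "T f"] C(2)[OF f]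
        f bop_mem[OF T(1) f]
      by (simp add: nrm_scale left_diff_distrib)
  qed
  then show ?thesis
    using that[of C] unfolding spec_def by force
qed

lemma spec_nonneg:
  assumes T: "bop T" "symm T" and pos: "\<And>f. f \<in> V \<Longrightarrow> 0 \<le> inn (T f) f" and t: "t \<in> spec T"
  shows "0 \<le> t"
proof (rule ccontr)
  assume "\<not> 0 \<le> t"
  have "invertible_op (\<lambda>f. T f - t *\<^sub>R f)"
  proof (rule coercive_invertible[OF bop_shift[OF T(1)] symm_shift[OF T]])
    show "0 < - t" using \<open>\<not> 0 \<le> t\<close> by simp
    show "- t * (nrm f)\<^sup>2 \<le> inn (T f - t *\<^sub>R f) f" if "f \<in> V" for f
      using pos[OF that] that bop_mem[OF T(1) that] by (simp add: inn_simps nrm_sq)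
  qed
  then show False using t by (simp add: spec_def)
qed

text \<open>
  If \<open>0 \<le> p \<le> M\<close> on the spectrum, then \<open>\<bar>M/2 - p\<bar> \<le> M/2\<close> there, so that \<open>M/2 - p(T)\<close> has norm at
  most \<open>M/2\<close>. This forces \<open>\<langle>p(T) f, f\<rangle> \<ge> 0\<close>.
\<close>

lemma papp_nonneg:
  assumes T: "bop T" "symm T" and ne: "\<exists>f\<in>V. f \<noteq> 0"
    and p: "\<And>t. t \<in> spec T \<Longrightarrow> 0 \<le> poly p t" and f: "f \<in> V"
  shows "0 \<le> inn (papp p T f) f"
proof -
  obtain b where b: "\<And>t. t \<in> spec T \<Longrightarrow> \<bar>t\<bar> \<le> b"
    using spec_bounded[OF T] by blast
  have "compact (poly p ` {-b..b})"
    by (intro compact_continuous_image continuous_intros) simp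
  then obtain M where M: "\<And>t. t \<in> {-b..b} \<Longrightarrow> \<bar>poly p t\<bar> \<le> M"
    using compact_imp_bounded[of "poly p ` {-b..b}"] unfolding bounded_real by blast
  define q where "q = [:M / 2:] - p"
  have "nrm (papp q T f) \<le> M / 2 * nrm f"
  proof (rule papp_norm_bound[OF T ne _ f])
    fix t assume t: "t \<in> spec T"
    then have "\<bar>poly p t\<bar> \<le> M" using b[OF t] by (intro M) auto
    moreover have "poly q t = M / 2 - poly p t" by (simp add: q_def)
    ultimately show "\<bar>poly q t\<bar> \<le> M / 2"
      using p[OF t] by (simp add: abs_if)
  qed
  then have "inn (papp q T f) f \<le> M / 2 * nrm f * nrm f"
    using cauchy_schwarz[OF papp_mem[OF T(1) f, of q] f] mult_right_mono[OF _ nrm_nonneg[OF f]]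
    by fastforce
  moreover have "inn (papp q T f) f = M / 2 * (nrm f * nrm f) - inn (papp p T f) f"
    using f papp_mem[OF T(1) f, of p]
    by (simp add: q_def papp_diff papp_pCons inn_simps nrm_sq flip: power2_eq_square)
  ultimately show ?thesis by simp
qed

section \<open>Continuous functional calculus of a symmetric operator\<close>

text \<open>
  The operator \<open>S\<close> is \<open>\<phi>(T)\<close>. The defining property is quantitative: a polynomial within \<open>e\<close> of
  \<open>\<phi>\<close> on the spectrum gives an operator within \<open>e\<close> of \<open>S\<close> in norm.
\<close>

definition is_calculus :: "('v \<Rightarrow> 'v) \<Rightarrow> (real \<Rightarrow> real) \<Rightarrow> ('v \<Rightarrow> 'v) \<Rightarrow> bool" where
  "is_calculus T \<phi> S \<longleftrightarrow> bop S \<and>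
     (\<forall>q e. (\<forall>t\<in>spec T. \<bar>poly q t - \<phi> t\<bar> \<le> e) \<longrightarrow> (\<forall>f\<in>V. nrm (papp q T f - S f) \<le> e * nrm f))"

definition approximable_on_spec :: "('v \<Rightarrow> 'v) \<Rightarrow> (real \<Rightarrow> real) \<Rightarrow> bool" where
  "approximable_on_spec T \<phi> \<longleftrightarrow> (\<forall>e>0. \<exists>q. \<forall>t\<in>spec T. \<bar>poly q t - \<phi> t\<bar> \<le> e)"

lemma is_calculus_bop: "is_calculus T \<phi> S \<Longrightarrow> bop S"
  by (simp add: is_calculus_def)

lemma is_calculusD:
  "\<lbrakk>is_calculus T \<phi> S; \<And>t. t \<in> spec T \<Longrightarrow> \<bar>poly q t - \<phi> t\<bar> \<le> e; f \<in> V\<rbrakk>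
    \<Longrightarrow> nrm (papp q T f - S f) \<le> e * nrm f"
  by (simp add: is_calculus_def)

lemma approximableD:
  assumes "approximable_on_spec T \<phi>" "e > 0"
  obtains q where "\<And>t. t \<in> spec T \<Longrightarrow> \<bar>poly q t - \<phi> t\<bar> \<le> e"
  using assms unfolding approximable_on_spec_def by blast

lemma approximable_sequence:
  assumes "approximable_on_spec T \<phi>"
  shows "\<exists>\<epsilon> p. \<epsilon> \<longlonglongrightarrow> (0::real) \<and> (\<forall>n. \<forall>t\<in>spec T. \<bar>poly (p n) t - \<phi> t\<bar> \<le> \<epsilon> n)"
proof -
  have "\<exists>q. \<forall>t\<in>spec T. \<bar>poly q t - \<phi> t\<bar> \<le> inverse (real (Suc n))" for n
    using assms inverse_Suc[of n] unfolding approximable_on_spec_def by blast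
  then have "\<exists>p. \<forall>n. \<forall>t\<in>spec T. \<bar>poly (p n) t - \<phi> t\<bar> \<le> inverse (real (Suc n))"
    by (intro choice) blast
  then show ?thesis
    using LIMSEQ_inverse_real_of_nat by blast
qed

lemma approximable_if_continuous:
  assumes "continuous_on {a..b} \<phi>" "spec T \<subseteq> {a..b}"
  shows "approximable_on_spec T \<phi>"
  using poly_approx_on_interval[OF assms(1)] assms(2) unfolding approximable_on_spec_def by blast

text \<open>
  The norm bound makes \<open>p\<^sub>n(T) f\<close> a Cauchy sequence whenever \<open>p\<^sub>n\<close> tends to \<open>\<phi>\<close> uniformly on the
  spectrum; its limit is \<open>S f\<close>.
\<close>

lemma calculus_exists:
  assumes T: "bop T" "symm T" and ne: "\<exists>f\<in>V. f \<noteq> 0" and appr: "approximable_on_spec T \<phi>"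
  shows "\<exists>S. is_calculus T \<phi> S"
proof -
  obtain \<epsilon> p where \<epsilon>: "\<epsilon> \<longlonglongrightarrow> 0" and "\<forall>n. \<forall>t\<in>spec T. \<bar>poly (p n) t - \<phi> t\<bar> \<le> \<epsilon> n"
    using approximable_sequence[OF appr] by blast
  then have p: "\<And>n t. t \<in> spec T \<Longrightarrow> \<bar>poly (p n) t - \<phi> t\<bar> \<le> \<epsilon> n"
    by blast
  have dist: "nrm (papp q T f - papp (p n) T f) \<le> (e + \<epsilon> n) * nrm f"
    if q: "\<And>t. t \<in> spec T \<Longrightarrow> \<bar>poly q t - \<phi> t\<bar> \<le> e" and f: "f \<in> V" for q e n f
  proof -
    have "\<bar>poly (q - p n) t\<bar> \<le> e + \<epsilon> n" if "t \<in> spec T" for t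
      using q[OF that] p[OF that, of n] by (simp add: abs_le_iff)
    then show ?thesis
      using papp_norm_bound[OF T ne _ f, of "q - p n" "e + \<epsilon> n"] by (simp add: papp_diff)
  qed
  have "\<exists>g\<in>V. (\<lambda>n. nrm (papp (p n) T f - g)) \<longlonglongrightarrow> 0" if f: "f \<in> V" for f
  proof (rule complete)
    show "papp (p n) T f \<in> V" for n using T(1) f by (rule papp_mem)
    fix e :: real assume "e > 0"
    have "(\<lambda>n. \<epsilon> n * nrm f) \<longlonglongrightarrow> 0"
      using tendsto_mult_left_zero[OF \<epsilon>] .
    then have "\<forall>\<^sub>F n in sequentially. \<epsilon> n * nrm f < e / 2"
      by (rule order_tendstoD) (use \<open>e > 0\<close> in simp)
    then obtain N where N: "\<And>n. n \<ge> N \<Longrightarrow> \<epsilon> n * nrm f < e / 2"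
      unfolding eventually_sequentially by blast
    have "nrm (papp (p m) T f - papp (p n) T f) < e" if "m \<ge> N" "n \<ge> N" for m n
      using dist[of "p m" "\<epsilon> m" f n, OF p f] N[OF that(1)] N[OF that(2)]
      by (simp add: distrib_right)
    then show "\<exists>N. \<forall>m\<ge>N. \<forall>n\<ge>N. nrm (papp (p m) T f - papp (p n) T f) < e" by blast
  qed
  then obtain S where S: "\<And>f. f \<in> V \<Longrightarrow> S f \<in> V"
    "\<And>f. f \<in> V \<Longrightarrow> (\<lambda>n. nrm (papp (p n) T f - S f)) \<longlonglongrightarrow> 0"
    by metis
  have approx: "nrm (papp q T f - S f) \<le> e * nrm f"
    if q: "\<And>t. t \<in> spec T \<Longrightarrow> \<bar>poly q t - \<phi> t\<bar> \<le> e" and f: "f \<in> V" for q e f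
  proof (rule LIMSEQ_le_const)
    have "(\<lambda>n. (e + \<epsilon> n) * nrm f + nrm (papp (p n) T f - S f)) \<longlonglongrightarrow> (e + 0) * nrm f + 0"
      by (rule tendsto_add[OF tendsto_mult[OF tendsto_add[OF tendsto_const \<epsilon>] tendsto_const] S(2)[OF f]])
    then show "(\<lambda>n. (e + \<epsilon> n) * nrm f + nrm (papp (p n) T f - S f)) \<longlonglongrightarrow> e * nrm f"
      by simp
    have "nrm (papp q T f - S f) \<le> (e + \<epsilon> n) * nrm f + nrm (papp (p n) T f - S f)" for n
      using nrm_triangle_diff[OF papp_mem[OF T(1) f, of q] papp_mem[OF T(1) f, of "p n"] S(1)[OF f]]
        dist[OF q f, of n] by linarith
    then show "\<exists>N. \<forall>n\<ge>N. nrm (papp q T f - S f) \<le> (e + \<epsilon> n) * nrm f + nrm (papp (p n) T f - S f)"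
      by blast
  qed
  have lim_unique: "g = S f" if f: "f \<in> V" and g: "g \<in> V" "(\<lambda>n. nrm (papp (p n) T f - g)) \<longlonglongrightarrow> 0"
    for f g
  proof -
    have "nrm (g - S f) \<le> 0"
    proof (rule LIMSEQ_le_const)
      show "(\<lambda>n. nrm (papp (p n) T f - g) + nrm (papp (p n) T f - S f)) \<longlonglongrightarrow> 0"
        using tendsto_add[OF g(2) S(2)[OF f]] by simp
      have "nrm (g - S f) \<le> nrm (papp (p n) T f - g) + nrm (papp (p n) T f - S f)" for n
        using nrm_triangle_diff[OF g(1) papp_mem[OF T(1) f, of "p n"] S(1)[OF f]]
          nrm_minus_commute[OF g(1) papp_mem[OF T(1) f, of "p n"]] by simp
      then show "\<exists>N. \<forall>n\<ge>N. nrm (g - S f) \<le> nrm (papp (p n) T f - g) + nrm (papp (p n) T f - S f)"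
        by blast
    qed
    then have "nrm (g - S f) = 0"
      using nrm_nonneg[OF diff_mem[OF g(1) S(1)[OF f]]] by simp
    then show ?thesis
      using diff_mem[OF g(1) S(1)[OF f]] by simp
  qed
  have add: "S (f + g) = S f + S g" if f: "f \<in> V" and g: "g \<in> V" for f g
  proof (rule lim_unique[symmetric])
    show "(\<lambda>n. nrm (papp (p n) T (f + g) - (S f + S g))) \<longlonglongrightarrow> 0"
    proof (rule Lim_null_comparison)
      show "(\<lambda>n. nrm (papp (p n) T f - S f) + nrm (papp (p n) T g - S g)) \<longlonglongrightarrow> 0"
        using tendsto_add[OF S(2)[OF f] S(2)[OF g]] by simp
      have "nrm (papp (p n) T (f + g) - (S f + S g))
          \<le> nrm (papp (p n) T f - S f) + nrm (papp (p n) T g - S g)" for n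
        using nrm_triangle[OF diff_mem[OF papp_mem[OF T(1) f] S(1)[OF f]]
            diff_mem[OF papp_mem[OF T(1) g] S(1)[OF g]], of "p n" "p n"]
        by (simp add: bop_add[OF bop_papp[OF T(1)] f g] algebra_simps)
      then show "\<forall>\<^sub>F n in sequentially. norm (nrm (papp (p n) T (f + g) - (S f + S g)))
          \<le> nrm (papp (p n) T f - S f) + nrm (papp (p n) T g - S g)"
        using f g S(1) papp_mem[OF T(1)] by simp
    qed
  qed (use f g S(1) in auto)
  have scale: "S (c *\<^sub>R f) = c *\<^sub>R S f" if f: "f \<in> V" for c f
  proof (rule lim_unique[symmetric])
    have "nrm (papp (p n) T (c *\<^sub>R f) - c *\<^sub>R S f) = \<bar>c\<bar> * nrm (papp (p n) T f - S f)" for n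
      using nrm_scale[OF diff_mem[OF papp_mem[OF T(1) f] S(1)[OF f]], of c "p n"]
      by (simp add: bop_scale[OF bop_papp[OF T(1)] f] scaleR_diff_right)
    then show "(\<lambda>n. nrm (papp (p n) T (c *\<^sub>R f) - c *\<^sub>R S f)) \<longlonglongrightarrow> 0"
      using tendsto_mult_right_zero[OF S(2)[OF f]] by simp
  qed (use f S(1) in auto)
  obtain C where C: "\<And>f. f \<in> V \<Longrightarrow> nrm (papp (p 0) T f) \<le> C * nrm f"
    using bop_bound[OF bop_papp[OF T(1)]] by blast
  have "nrm (S f) \<le> (C + \<epsilon> 0) * nrm f" if f: "f \<in> V" for f
    using nrm_diff_ineq[OF papp_mem[OF T(1) f, of "p 0"] S(1)[OF f]] C[OF f]
      approx[of "p 0" "\<epsilon> 0", OF p f] by (simp add: distrib_right)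
  then have "bop S"
    using S(1) add scale by (rule bopI[rotated 3])
  then show ?thesis
    using approx unfolding is_calculus_def by blast
qed

lemma calculus_symm:
  assumes T: "bop T" "symm T" and appr: "approximable_on_spec T \<phi>" and S: "is_calculus T \<phi> S"
  shows "symm S"
  unfolding symm_def
proof (intro ballI)
  fix f g assume f: "f \<in> V" and g: "g \<in> V"
  note mem = f g bop_mem[OF is_calculus_bop[OF S]] papp_mem[OF T(1)]
  have "\<bar>inn (S f) g - inn f (S g)\<bar> \<le> 0"
  proof (rule le_if_le_plus_multiples)
    fix e :: real assume "e > 0"
    then obtain q where q: "\<And>t. t \<in> spec T \<Longrightarrow> \<bar>poly q t - \<phi> t\<bar> \<le> e"
      using approximableD[OF appr] by blast
    have "inn (papp q T f) g = inn f (papp q T g)"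
      using symm_papp[OF T] f g by (simp add: symm_def)
    then have "inn (S f) g - inn f (S g) = inn f (papp q T g - S g) - inn (papp q T f - S f) g"
      using mem by (simp add: inn_simps)
    also have "\<bar>\<dots>\<bar> \<le> \<bar>inn f (papp q T g - S g)\<bar> + \<bar>inn (papp q T f - S f) g\<bar>"
      by (rule abs_triangle_ineq4)
    also have "\<dots> \<le> nrm f * nrm (papp q T g - S g) + nrm (papp q T f - S f) * nrm g"
      using mem by (intro add_mono cauchy_schwarz diff_mem) auto
    also have "\<dots> \<le> nrm f * (e * nrm g) + (e * nrm f) * nrm g"
      using f g q by (intro add_mono mult_left_mono mult_right_mono is_calculusD[OF S]) auto
    finally show "\<bar>inn (S f) g - inn f (S g)\<bar> \<le> 0 + e * (2 * nrm f * nrm g)"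
      by (simp add: algebra_simps)
  qed
  then show "inn (S f) g = inn f (S g)" by simp
qed

text \<open>
  If \<open>p\<close> is within \<open>e\<close> of \<open>\<phi>\<close>, then \<open>p + e - q\<close> is nonnegative on the spectrum, and so is the quadratic
  form of \<open>p(T) + e - q(T)\<close>. Now let \<open>e\<close> tend to \<open>0\<close>.
\<close>

lemma calculus_ge_poly:
  assumes T: "bop T" "symm T" and ne: "\<exists>f\<in>V. f \<noteq> 0" and appr: "approximable_on_spec T \<phi>"
    and S: "is_calculus T \<phi> S" and le: "\<And>t. t \<in> spec T \<Longrightarrow> poly q t \<le> \<phi> t" and f: "f \<in> V"
  shows "inn (papp q T f) f \<le> inn (S f) f"
proof (rule le_if_le_plus_multiples)
  fix e :: real assume "e > 0"
  then obtain p where p: "\<And>t. t \<in> spec T \<Longrightarrow> \<bar>poly p t - \<phi> t\<bar> \<le> e"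
    using approximableD[OF appr] by blast
  note mem = f bop_mem[OF is_calculus_bop[OF S] f] papp_mem[OF T(1) f]
  have "0 \<le> inn (papp (p + [:e:] - q) T f) f"
  proof (rule papp_nonneg[OF T ne _ f])
    fix t assume t: "t \<in> spec T"
    then show "0 \<le> poly (p + [:e:] - q) t"
      using p[OF t] le[OF t] by (simp add: abs_le_iff)
  qed
  then have "inn (papp q T f) f \<le> inn (papp p T f) f + e * (nrm f)\<^sup>2"
    using mem by (simp add: papp_diff papp_add papp_pCons inn_simps nrm_sq)
  moreover have "inn (papp p T f - S f) f \<le> (e * nrm f) * nrm f"
  proof -
    have "inn (papp p T f - S f) f \<le> nrm (papp p T f - S f) * nrm f"
      using cauchy_schwarz[of "papp p T f - S f" f] mem by simp
    also have "\<dots> \<le> (e * nrm f) * nrm f"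
      using f p by (intro mult_right_mono is_calculusD[OF S]) auto
    finally show ?thesis .
  qed
  ultimately show "inn (papp q T f) f \<le> inn (S f) f + e * (2 * (nrm f)\<^sup>2)"
    using mem by (simp add: inn_simps power2_eq_square algebra_simps)
qed

text \<open>
  The weak form of \<open>\<phi>(T)\<^sup>2 = T\<close>: if \<open>p\<^sub>n\<close> tends to \<open>\<phi>\<close>, then \<open>p\<^sub>n\<^sup>2\<close> tends to the identity function, both
  uniformly on the spectrum, and \<open>\<parallel>p\<^sub>n(T) f\<parallel>\<^sup>2 = \<langle>p\<^sub>n\<^sup>2(T) f, f\<rangle>\<close> converges to both sides.
\<close>

lemma calculus_sqrt_norm:
  assumes T: "bop T" "symm T" and ne: "\<exists>f\<in>V. f \<noteq> 0" and appr: "approximable_on_spec T \<phi>"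
    and S: "is_calculus T \<phi> S" and f: "f \<in> V"
    and sq: "\<And>t. t \<in> spec T \<Longrightarrow> (\<phi> t)\<^sup>2 = t" 
  shows "(nrm (S f))\<^sup>2 = inn (T f) f"
proof -
  note mem = f bop_mem[OF is_calculus_bop[OF S] f] papp_mem[OF T(1) f] bop_mem[OF T(1) f]
  obtain b where b: "\<And>t. t \<in> spec T \<Longrightarrow> \<bar>t\<bar> \<le> b"
    using spec_bounded[OF T] by blast
  have \<phi>_le: "\<bar>\<phi> t\<bar> \<le> b + 1" if "t \<in> spec T" for t
  proof -
    have "2 * \<bar>\<phi> t\<bar> \<le> (\<phi> t)\<^sup>2 + 1"
      using zero_le_power2[of "\<bar>\<phi> t\<bar> - 1"] by (simp add: power2_eq_square algebra_simps)
    then show ?thesis using b[OF that] sq[OF that] abs_ge_zero[of "\<phi> t"] by linarith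
  qed
  obtain \<epsilon> p where \<epsilon>: "\<epsilon> \<longlonglongrightarrow> 0" and "\<forall>n. \<forall>t\<in>spec T. \<bar>poly (p n) t - \<phi> t\<bar> \<le> \<epsilon> n"
    using approximable_sequence[OF appr] by blast
  then have p: "\<And>n t. t \<in> spec T \<Longrightarrow> \<bar>poly (p n) t - \<phi> t\<bar> \<le> \<epsilon> n"
    by blast
  have "(\<lambda>n. nrm (papp (p n) T f) - nrm (S f)) \<longlonglongrightarrow> 0"
  proof (rule Lim_null_comparison)
    show "(\<lambda>n. \<epsilon> n * nrm f) \<longlonglongrightarrow> 0"
      using tendsto_mult_left_zero[OF \<epsilon>] .
    have "\<bar>nrm (papp (p n) T f) - nrm (S f)\<bar> \<le> \<epsilon> n * nrm f" for n
      using nrm_diff_ineq[OF mem(3,2), of "p n"] is_calculusD[OF S p f, of n] by linarith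
    then show "\<forall>\<^sub>F n in sequentially. norm (nrm (papp (p n) T f) - nrm (S f)) \<le> \<epsilon> n * nrm f"
      by simp
  qed
  then have 1: "(\<lambda>n. (nrm (papp (p n) T f))\<^sup>2) \<longlonglongrightarrow> (nrm (S f))\<^sup>2"
    by (intro tendsto_power) (simp add: LIM_zero_iff)
  have "(\<lambda>n. (nrm (papp (p n) T f))\<^sup>2 - inn (T f) f) \<longlonglongrightarrow> 0"
  proof (rule Lim_null_comparison)
    have "(\<lambda>n. \<epsilon> n * (2 * (b + 1) + \<epsilon> n) * (nrm f)\<^sup>2) \<longlonglongrightarrow> 0 * (2 * (b + 1) + 0) * (nrm f)\<^sup>2"
      by (intro tendsto_mult tendsto_add tendsto_const \<epsilon>)
    then show "(\<lambda>n. \<epsilon> n * (2 * (b + 1) + \<epsilon> n) * (nrm f)\<^sup>2) \<longlonglongrightarrow> 0" by simp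
    have "\<bar>(nrm (papp (p n) T f))\<^sup>2 - inn (T f) f\<bar> \<le> \<epsilon> n * (2 * (b + 1) + \<epsilon> n) * (nrm f)\<^sup>2" for n
    proof -
      define q where "q = p n * p n - [:0, 1:]"
      have q_le: "nrm (papp q T f) \<le> \<epsilon> n * (2 * (b + 1) + \<epsilon> n) * nrm f"
      proof (rule papp_norm_bound[OF T ne _ f])
        fix t assume t: "t \<in> spec T"
        have "poly q t = (poly (p n) t - \<phi> t) * (poly (p n) t + \<phi> t)"
          using sq[OF t] by (simp add: q_def algebra_simps power2_eq_square)
        also have "\<bar>\<dots>\<bar> \<le> \<epsilon> n * (2 * (b + 1) + \<epsilon> n)"
          unfolding abs_mult using p[OF t, of n] \<phi>_le[OF t] by (intro mult_mono) auto
        finally show "\<bar>poly q t\<bar> \<le> \<epsilon> n * (2 * (b + 1) + \<epsilon> n)" .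
      qed
      have "inn (papp (p n) T (papp (p n) T f)) f = inn (papp (p n) T f) (papp (p n) T f)"
        using symm_papp[OF T] mem by (simp add: symm_def)
      then have "(nrm (papp (p n) T f))\<^sup>2 - inn (T f) f = inn (papp q T f) f"
        using mem papp_mem[OF T(1) mem(3)] T(1)
        by (simp add: q_def papp_diff papp_mult papp_pCons inn_simps nrm_sq)
      also have "\<bar>\<dots>\<bar> \<le> nrm (papp q T f) * nrm f"
        using mem by (intro cauchy_schwarz) auto
      also have "\<dots> \<le> \<epsilon> n * (2 * (b + 1) + \<epsilon> n) * nrm f * nrm f"
        using f q_le by (intro mult_right_mono) auto
      finally show ?thesis by (simp add: power2_eq_square mult.assoc)
    qed
    then show "\<forall>\<^sub>F n in sequentially. norm ((nrm (papp (p n) T f))\<^sup>2 - inn (T f) f)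
        \<le> \<epsilon> n * (2 * (b + 1) + \<epsilon> n) * (nrm f)\<^sup>2"
      by simp
  qed
  then have "(\<lambda>n. (nrm (papp (p n) T f))\<^sup>2) \<longlonglongrightarrow> inn (T f) f"
    by (simp add: LIM_zero_iff)
  then show ?thesis
    using 1 LIMSEQ_unique by blast
qed

section \<open>Powers of positive operators\<close>

definition psd :: "('v \<Rightarrow> 'v) \<Rightarrow> bool" where
  "psd T \<longleftrightarrow> bop T \<and> symm T \<and> (\<forall>f\<in>V. 0 \<le> inn (T f) f)"

lemma psd_approximable_powr:
  assumes "psd T" "s > 0"
  shows "approximable_on_spec T (\<lambda>t. t powr s)"
proof -
  obtain b where b: "\<And>t. t \<in> spec T \<Longrightarrow> \<bar>t\<bar> \<le> b"
    using spec_bounded assms(1) unfolding psd_def by blast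
  show ?thesis
  proof (rule approximable_if_continuous)
    show "continuous_on {0..b} (\<lambda>t. t powr s)"
      using assms(2) by (intro continuous_on_powr' continuous_intros) auto
    show "spec T \<subseteq> {0..b}"
      using b spec_nonneg assms(1) unfolding psd_def by force
  qed
qed

lemma psd_calculus_powr:
  assumes T: "psd T" and ne: "\<exists>f\<in>V. f \<noteq> 0" and s: "s > 0" and S: "is_calculus T (\<lambda>t. t powr s) S"
  shows "psd S"
proof -
  have T': "bop T" "symm T" using T by (auto simp: psd_def)
  have "0 \<le> inn (S f) f" if "f \<in> V" for f
    using calculus_ge_poly[OF T' ne psd_approximable_powr[OF T s] S, of 0 f] that by simp
  then show ?thesis
    using is_calculus_bop[OF S] calculus_symm[OF T' psd_approximable_powr[OF T s] S]
    by (simp add: psd_def)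
qed

lemma calculus_half_norm:
  assumes T: "psd T" and ne: "\<exists>f\<in>V. f \<noteq> 0" and S: "is_calculus T (\<lambda>t. t powr (1 / 2)) S"
    and f: "f \<in> V"
  shows "(nrm (S f))\<^sup>2 = inn (T f) f"
proof -
  have T': "bop T" "symm T" using T by (auto simp: psd_def)
  have "(t powr (1 / 2))\<^sup>2 = t" if "t \<in> spec T" for t
    using spec_nonneg[OF T' _ that] T by (simp add: psd_def powr_half_sqrt)
  then show ?thesis
    using calculus_sqrt_norm[OF T' ne psd_approximable_powr[OF T] S f] by simp
qed

text \<open>
  Jensen's inequality for the convex function \<open>u\<^sup>r\<close> of \<open>u = t\<^sup>2\<close>, where \<open>\<langle>T\<^sup>2 f, f\<rangle>\<close> is the mean of \<open>u\<close>.
  As usual it follows from the tangent at the mean, which here is a polynomial of degree 2 in \<open>t\<close>.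
\<close>

lemma calculus_power_jensen:
  assumes T: "psd T" and ne: "\<exists>f\<in>V. f \<noteq> 0" and r: "r \<ge> 1"
    and S: "is_calculus T (\<lambda>t. t powr (2 * r)) S" and f: "f \<in> V" "nrm f = 1"
  shows "(nrm (T f)) powr (2 * r) \<le> inn (S f) f"
proof (cases "nrm (T f) = 0")
  case True
  then show ?thesis
    using psd_calculus_powr[OF T ne _ S] r f by (simp add: psd_def)
next
  case False
  have T': "bop T" "symm T" using T by (auto simp: psd_def)
  define v where "v = (nrm (T f))\<^sup>2"
  have v: "v > 0" using False by (simp add: v_def)
  have nT: "nrm (T f) > 0" using False nrm_nonneg[OF bop_mem[OF T'(1) f(1)]] by simp
  \<comment> \<open>\<open>q\<close> is the tangent of \<open>u powr r\<close> at \<open>u = v\<close>, taken at \<open>u = t\<^sup>2\<close>; its constant term is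
    \<open>v powr r - k * v\<close> and its slope \<open>k\<close>.\<close>
  define k where "k = r * v powr (r - 1)"
  define q where "q = [:v powr r - k * v, 0, k:]"
  have "inn (papp q T f) f \<le> inn (S f) f"
  proof (rule calculus_ge_poly[OF T' ne psd_approximable_powr[OF T] S _ f(1)])
    fix t assume "t \<in> spec T"
    then have t: "t \<ge> 0" using spec_nonneg[OF T'] T by (auto simp: psd_def)
    have "poly q t = v powr r + r * v powr (r - 1) * (t\<^sup>2 - v)"
      by (simp add: q_def k_def algebra_simps power2_eq_square)
    also have "\<dots> \<le> (t\<^sup>2) powr r"
      using v r by (intro powr_above_tangent) auto
    also have "\<dots> = t powr (2 * r)"
      using t by (rule powr_power2)
    finally show "poly q t \<le> t powr (2 * r)" .
  qed (use r in simp)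
  moreover have "inn (papp q T f) f = v powr r"
  proof -
    have "inn (T (T f)) f = v"
      using T'(2) f bop_mem[OF T'(1)] by (simp add: symm_def v_def nrm_sq)
    moreover have "inn f f = 1"
      using f nrm_sq[of f] by simp
    ultimately show ?thesis
      using f bop_mem[OF T'(1)] by (simp add: q_def papp_pCons inn_simps)
  qed
  moreover have "v powr r = nrm (T f) powr (2 * r)"
    unfolding v_def using nT by (intro powr_power2) simp
  ultimately show ?thesis by simp
qed

end

section \<open>Complex functions as a real vector space\<close>

instantiation "fun" :: (type, real_vector) real_vector
begin

definition scaleR_fun_def: "scaleR c f = (\<lambda>x. c *\<^sub>R f x)"

instance
  by standard (auto simp: scaleR_fun_def fun_eq_iff scaleR_add_right scaleR_add_left)

end

lemma plus_fun_eq: "f + g = (\<lambda>x. f x + g x)"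
  by (simp add: plus_fun_def)

lemma minus_fun_eq: "f - g = (\<lambda>x. f x - g x)"
  by (simp add: fun_diff_def)

lemma scaleR_fun_eq: "c *\<^sub>R f = (\<lambda>x. complex_of_real c * f x)"
  by (simp add: scaleR_fun_def scaleR_conv_of_real)

lemma sum_fun_apply: "(\<Sum>i\<in>I. g i) x = (\<Sum>i\<in>I. g i x)"
  for g :: "'i \<Rightarrow> 'a \<Rightarrow> 'b::comm_monoid_add"
  by (induction I rule: infinite_finite_induct) auto

section \<open>Reproducing kernel spaces as real Hilbert spaces\<close>

context rkhs
begin

lemma of_real_scalars: "complex_of_real c \<in> scalars X"
  by (rule disjE[OF scalars]) simp_all

text \<open>
  Taking real parts loses nothing: \<open>Re \<langle>f, f\<rangle> = \<langle>f, f\<rangle>\<close>, and \<open>Re\<close> of a complex linear functional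
  determines it.
\<close>

sublocale H: real_hilbert "vectors X" "\<lambda>f g. Re (ip X f g)"
proof
  show "0 \<in> vectors X"
    using vectors_zero by (simp add: zero_fun_def)
  show "f + g \<in> vectors X" if "f \<in> vectors X" "g \<in> vectors X" for f g
    using vectors_add[OF that] by (simp add: plus_fun_eq)
  show "c *\<^sub>R f \<in> vectors X" if "f \<in> vectors X" for c f
    using vectors_scale[OF of_real_scalars that] by (simp add: scaleR_fun_eq)
  show "Re (ip X (f + g) h) = Re (ip X f h) + Re (ip X g h)"
    if "f \<in> vectors X" "g \<in> vectors X" "h \<in> vectors X" for f g h
    using ip_add[OF that] by (simp add: plus_fun_eq)
  show "Re (ip X (c *\<^sub>R f) g) = c * Re (ip X f g)" if "f \<in> vectors X" "g \<in> vectors X" for c f g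
    using ip_scale[OF of_real_scalars that] by (simp add: scaleR_fun_eq)
  show "Re (ip X f g) = Re (ip X g f)" if "f \<in> vectors X" "g \<in> vectors X" for f g
    using ip_cnj[OF that] by simp
  show "0 \<le> Re (ip X f f)" if "f \<in> vectors X" for f
    using ip_nonneg[OF that] .
  show "f = 0" if "f \<in> vectors X" "Re (ip X f f) = 0" for f
  proof -
    have "Im (ip X f f) = 0"
      using arg_cong[OF ip_cnj[OF that(1) that(1)], of Im] by simp
    then have "ip X f f = 0"
      using that(2) by (simp add: complex_eq_iff)
    then show ?thesis
      using ip_definite[OF that(1)] by (simp add: zero_fun_def)
  qed
  show "\<exists>f\<in>vectors X. (\<lambda>n. sqrt (Re (ip X (u n - f) (u n - f)))) \<longlonglongrightarrow> 0"
    if "\<And>n::nat. u n \<in> vectors X"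
      "\<forall>e>0. \<exists>N. \<forall>m\<ge>N. \<forall>n\<ge>N. sqrt (Re (ip X (u m - u n) (u m - u n))) < e" for u
    using complete[of u, OF that(1)] that(2) unfolding hnorm_def minus_fun_eq by simp
qed

lemma hnorm_eq_nrm: "hnorm X f = H.nrm f"
  by (simp add: hnorm_def H.nrm_def)

abbreviation smult_fun :: "complex \<Rightarrow> ('a \<Rightarrow> complex) \<Rightarrow> 'a \<Rightarrow> complex" where
  "smult_fun c f \<equiv> (\<lambda>x. c * f x)"

lemma ip_add_left: "\<lbrakk>f \<in> vectors X; g \<in> vectors X; h \<in> vectors X\<rbrakk> \<Longrightarrow> ip X (f + g) h = ip X f h + ip X g h"
  using ip_add by (simp add: plus_fun_eq)

lemma ip_add_right: "\<lbrakk>f \<in> vectors X; g \<in> vectors X; h \<in> vectors X\<rbrakk> \<Longrightarrow> ip X h (f + g) = ip X h f + ip X h g"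
  by (metis H.add_mem ip_add_left ip_cnj complex_cnj_add)

lemma ip_scale_right:
  assumes "c \<in> scalars X" "f \<in> vectors X" "g \<in> vectors X"
  shows "ip X g (smult_fun c f) = cnj c * ip X g f"
  using ip_cnj[OF vectors_scale[OF assms(1,2)] assms(3)] ip_cnj[OF assms(2,3)] ip_scale[OF assms]
  by simp

lemma ip_self: "f \<in> vectors X \<Longrightarrow> ip X f f = complex_of_real ((hnorm X f)\<^sup>2)"
  using ip_cnj[of f f] ip_nonneg[of f] by (simp add: hnorm_def complex_eq_iff)

lemma hnorm_scale:
  assumes "c \<in> scalars X" "f \<in> vectors X"
  shows "hnorm X (smult_fun c f) = cmod c * hnorm X f"
proof -
  have "ip X (smult_fun c f) (smult_fun c f) = c * cnj c * ip X f f"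
    using assms vectors_scale[OF assms] by (simp add: ip_scale ip_scale_right)
  then have "Re (ip X (smult_fun c f) (smult_fun c f)) = (cmod c)\<^sup>2 * Re (ip X f f)"
    by (simp add: complex_norm_square [symmetric] del: of_real_power) 
  then show ?thesis
    by (simp add: hnorm_def real_sqrt_mult)
qed

text \<open>
  Multiplying \<open>f\<close> by a unimodular scalar makes \<open>\<langle>f, g\<rangle>\<close> real and nonnegative, which reduces the claim to
  the real inner product. For real scalars the factor is a sign.
\<close>

lemma ip_cauchy_schwarz:
  assumes "f \<in> vectors X" "g \<in> vectors X"
  shows "cmod (ip X f g) \<le> hnorm X f * hnorm X g"
proof (cases "ip X f g = 0")
  case True
  then show ?thesis using assms by (simp add: hnorm_eq_nrm)
next
  case False
  define z where "z = ip X f g"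
  define c where "c = cnj z / complex_of_real (cmod z)"
  have "z \<in> scalars X" using ip_value[OF assms] by (simp add: z_def)
  then have c: "c \<in> scalars X"
    using scalars by (elim disjE) (auto simp: c_def elim!: Reals_cases)
  have "cmod c = 1" using False by (simp add: c_def z_def norm_divide)
  have "z * cnj z = complex_of_real (cmod z) * complex_of_real (cmod z)"
    using complex_norm_square[of z] by (simp add: power2_eq_square)
  then have "c * z = complex_of_real (cmod z)"
    using False by (simp add: c_def z_def mult.commute)
  then have "cmod z = Re (ip X (smult_fun c f) g)"
    using ip_scale[OF c assms] by (simp add: z_def)
  also have "\<dots> \<le> hnorm X (smult_fun c f) * hnorm X g"
    using H.cauchy_schwarz[OF vectors_scale[OF c assms(1)] assms(2)] by (simp add: hnorm_eq_nrm)
  finally show ?thesis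
    using hnorm_scale[OF c assms(1)] \<open>cmod c = 1\<close> by (simp add: z_def)
qed

lemma ip_eqI:
  assumes "u \<in> vectors X" "v \<in> vectors X" "\<And>f. f \<in> vectors X \<Longrightarrow> ip X f u = ip X f v"
  shows "u = v"
proof (rule H.inn_eqI[OF assms(1,2)])
  fix h assume h: "h \<in> vectors X"
  show "Re (ip X u h) = Re (ip X v h)"
    using ip_cnj[OF h assms(1)] ip_cnj[OF h assms(2)] assms(3)[OF h] by simp
qed

section \<open>Riesz representation, kernels and adjoints\<close>

text \<open>
  The real part of \<open>\<phi>\<close> is represented by a vector \<open>u\<close> for the real inner product. Over the complex
  numbers, the same identity at \<open>\<i> h\<close> compares the imaginary parts; over the reals there are none.
\<close>

lemma riesz:
  assumes add: "\<And>f g. \<lbrakk>f \<in> vectors X; g \<in> vectors X\<rbrakk> \<Longrightarrow> \<phi> (f + g) = \<phi> f + \<phi> g"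
    and scale: "\<And>c f. \<lbrakk>c \<in> scalars X; f \<in> vectors X\<rbrakk> \<Longrightarrow> \<phi> (smult_fun c f) = c * \<phi> f"
    and val: "\<And>f. f \<in> vectors X \<Longrightarrow> \<phi> f \<in> scalars X"
    and bound: "\<And>f. f \<in> vectors X \<Longrightarrow> cmod (\<phi> f) \<le> C * hnorm X f"
  shows "\<exists>!k. k \<in> vectors X \<and> (\<forall>f\<in>vectors X. \<phi> f = ip X f k)"
proof -
  have "\<exists>u\<in>vectors X. \<forall>h\<in>vectors X. Re (ip X u h) = Re (\<phi> h)"
  proof (rule H.symmetric_lax_milgram[of "\<lambda>f. f" 1 "\<lambda>f. Re (\<phi> f)" C])
    show "H.bop (\<lambda>f. f)" by (rule H.bop_ident)
    show "H.symm (\<lambda>f. f)" by (simp add: H.symm_def)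
    show "1 * (H.nrm f)\<^sup>2 \<le> Re (ip X f f)" if "f \<in> vectors X" for f
      using that by (simp add: H.nrm_sq)
    show "Re (\<phi> (f + g)) = Re (\<phi> f) + Re (\<phi> g)" if "f \<in> vectors X" "g \<in> vectors X" for f g
      using add[OF that] by simp
    show "Re (\<phi> (a *\<^sub>R f)) = a * Re (\<phi> f)" if "f \<in> vectors X" for a f
      using scale[OF of_real_scalars that] by (simp add: scaleR_fun_eq)
    show "\<bar>Re (\<phi> f)\<bar> \<le> C * H.nrm f" if "f \<in> vectors X" for f
      using order_trans[OF abs_Re_le_cmod bound[OF that]] by (simp add: hnorm_eq_nrm)
  qed simp
  then obtain u where u: "u \<in> vectors X" "\<forall>h\<in>vectors X. Re (ip X u h) = Re (\<phi> h)"
    by blast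
  have Re_eq: "Re (\<phi> h) = Re (ip X h u)" if "h \<in> vectors X" for h
    using u that ip_cnj[OF u(1) that] by simp
  have eq: "\<phi> h = ip X h u" if h: "h \<in> vectors X" for h
  proof (cases "scalars X = UNIV")
    case True
    then have i: "\<i> \<in> scalars X" by simp
    have "Re (\<i> * \<phi> h) = Re (\<i> * ip X h u)"
      using Re_eq[OF vectors_scale[OF i h]] scale[OF i h] ip_scale[OF i h u(1)] by simp
    then show ?thesis
      using Re_eq[OF h] by (simp add: complex_eq_iff)
  next
    case False
    then have "scalars X = \<real>" using scalars by simp
    then have "\<phi> h \<in> \<real>" "ip X h u \<in> \<real>"
      using val[OF h] ip_value[OF h u(1)] by simp_all
    then show ?thesis
      using Re_eq[OF h] by (simp add: complex_eq_iff complex_is_Real_iff)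
  qed
  show ?thesis
  proof (rule ex1I[of _ u])
    show "u \<in> vectors X \<and> (\<forall>f\<in>vectors X. \<phi> f = ip X f u)"
      using u(1) eq by simp
    show "k = u" if k: "k \<in> vectors X \<and> (\<forall>f\<in>vectors X. \<phi> f = ip X f k)" for k
      using k u(1) by (intro ip_eqI) (auto simp: eq [symmetric])
  qed
qed

lemma repr_kernel_mem: "repr_kernel X l \<in> vectors X"
proof -
  obtain C where C: "\<forall>f\<in>vectors X. cmod (f l) \<le> C * hnorm X f"
    using evaluation_bounded by blast
  have "\<exists>!k. k \<in> vectors X \<and> (\<forall>f\<in>vectors X. f l = ip X f k)"
    by (rule riesz[where \<phi> = "\<lambda>f. f l" and C = C]) (use C vectors_value in auto)
  from theI'[OF this] show ?thesis
    unfolding repr_kernel_def by blast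
qed

lemma bounded_opsD:
  assumes "A \<in> bounded_ops X"
  shows bounded_ops_bop: "H.bop A"
    and bounded_ops_scale: "\<lbrakk>c \<in> scalars X; f \<in> vectors X\<rbrakk> \<Longrightarrow> A (smult_fun c f) = smult_fun c (A f)"
    and bounded_ops_mem: "f \<in> vectors X \<Longrightarrow> A f \<in> vectors X"
proof -
  show "c \<in> scalars X \<Longrightarrow> f \<in> vectors X \<Longrightarrow> A (smult_fun c f) = smult_fun c (A f)"
    and mem: "f \<in> vectors X \<Longrightarrow> A f \<in> vectors X" for c f
    using assms by (simp_all add: bounded_ops_def)
  obtain C where "\<forall>f\<in>vectors X. hnorm X (A f) \<le> C * hnorm X f"
    using assms unfolding bounded_ops_def by blast
  moreover have "A (c *\<^sub>R f) = c *\<^sub>R A f" if "f \<in> vectors X" for c f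
    using assms of_real_scalars[of c] that by (simp add: bounded_ops_def scaleR_fun_eq)
  moreover have "A (f + g) = A f + A g" if "f \<in> vectors X" "g \<in> vectors X" for f g
    using assms that by (simp add: bounded_ops_def plus_fun_eq)
  ultimately show "H.bop A"
    using mem by (intro H.bopI[of A C]) (simp_all add: hnorm_eq_nrm)
qed

lemma bounded_opsI:
  assumes "H.bop A"
    and "\<And>c f. \<lbrakk>c \<in> scalars X; f \<in> vectors X\<rbrakk> \<Longrightarrow> A (smult_fun c f) = smult_fun c (A f)"
  shows "A \<in> bounded_ops X"
proof -
  obtain C where "\<And>f. f \<in> vectors X \<Longrightarrow> H.nrm (A f) \<le> C * H.nrm f"
    using H.bop_bound[OF assms(1)] by blast
  then have C: "\<exists>C. \<forall>f\<in>vectors X. H.nrm (A f) \<le> C * H.nrm f"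
    by blast
  show ?thesis
    unfolding bounded_ops_def mem_Collect_eq hnorm_eq_nrm
  proof (intro conjI ballI C)
    show "A f \<in> vectors X" if "f \<in> vectors X" for f
      using H.bop_mem[OF assms(1) that] .
    show "A (\<lambda>x. f x + g x) = (\<lambda>x. A f x + A g x)" if "f \<in> vectors X" "g \<in> vectors X" for f g
      using H.bop_add[OF assms(1) that] unfolding plus_fun_eq .
    show "A (\<lambda>x. c * f x) = (\<lambda>x. c * A f x)" if "c \<in> scalars X" "f \<in> vectors X" for c f
      using assms(2)[OF that] .
  qed
qed

lemma bounded_ops_bound:
  assumes "A \<in> bounded_ops X"
  obtains C where "C > 0" "\<And>f. f \<in> vectors X \<Longrightarrow> hnorm X (A f) \<le> C * hnorm X f"
proof -
  obtain C where "C > 0" "\<And>f. f \<in> vectors X \<Longrightarrow> H.nrm (A f) \<le> C * H.nrm f"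
    using H.bop_bound[OF bounded_ops_bop[OF assms]] by blast
  then show ?thesis using that[of C] by (simp add: hnorm_eq_nrm)
qed

lemma adj_exists:
  assumes A: "A \<in> bounded_ops X" and g: "g \<in> vectors X"
  shows "\<exists>!h. h \<in> vectors X \<and> (\<forall>f\<in>vectors X. ip X (A f) g = ip X f h)"
proof -
  obtain C where C: "C > 0" "\<And>f. f \<in> vectors X \<Longrightarrow> hnorm X (A f) \<le> C * hnorm X f"
    using bounded_ops_bound[OF A] by blast
  show ?thesis
  proof (rule riesz[where \<phi> = "\<lambda>f. ip X (A f) g" and C = "C * hnorm X g"])
    show "ip X (A (f + h)) g = ip X (A f) g + ip X (A h) g" if "f \<in> vectors X" "h \<in> vectors X" for f h
      using that g bounded_ops_mem[OF A] H.bop_add[OF bounded_ops_bop[OF A] that]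
      by (simp add: ip_add_left)
    show "ip X (A (smult_fun c f)) g = c * ip X (A f) g" if "c \<in> scalars X" "f \<in> vectors X" for c f
      using bounded_ops_scale[OF A that] ip_scale[OF that(1) bounded_ops_mem[OF A that(2)] g] by simp
    show "ip X (A f) g \<in> scalars X" if "f \<in> vectors X" for f
      using ip_value[OF bounded_ops_mem[OF A that] g] .
    show "cmod (ip X (A f) g) \<le> C * hnorm X g * hnorm X f" if "f \<in> vectors X" for f
    proof -
      have "cmod (ip X (A f) g) \<le> hnorm X (A f) * hnorm X g"
        using ip_cauchy_schwarz[OF bounded_ops_mem[OF A that] g] .
      also have "\<dots> \<le> (C * hnorm X f) * hnorm X g"
        using C(2)[OF that] g by (intro mult_right_mono) (simp_all add: hnorm_eq_nrm)
      finally show ?thesis by (simp add: ac_simps)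
    qed
  qed
qed

lemma adj_mem: "\<lbrakk>A \<in> bounded_ops X; g \<in> vectors X\<rbrakk> \<Longrightarrow> adj X A g \<in> vectors X"
  and ip_adj: "\<lbrakk>A \<in> bounded_ops X; g \<in> vectors X; f \<in> vectors X\<rbrakk> \<Longrightarrow> ip X (A f) g = ip X f (adj X A g)"
proof -
  assume "A \<in> bounded_ops X" "g \<in> vectors X"
  note * = theI'[OF adj_exists[OF this], folded adj_def]
  show "adj X A g \<in> vectors X" using * by (rule conjunct1)
  show "ip X (A f) g = ip X f (adj X A g)" if "f \<in> vectors X"
    using bspec[OF conjunct2[OF *] that] .
qed

text \<open>
  Linearity follows from uniqueness of the representing vector; the bound comes from
  \<open>\<parallel>A\<^sup>* g\<parallel>\<^sup>2 = \<langle>A A\<^sup>* g, g\<rangle> \<le> C \<parallel>A\<^sup>* g\<parallel> \<parallel>g\<parallel>\<close>.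
\<close>

lemma adj_bounded_ops:
  assumes A: "A \<in> bounded_ops X"
  shows "adj X A \<in> bounded_ops X"
proof (rule bounded_opsI)
  note mem = adj_mem[OF A] bounded_ops_mem[OF A]
  obtain C where C: "C > 0" "\<And>f. f \<in> vectors X \<Longrightarrow> hnorm X (A f) \<le> C * hnorm X f"
    using bounded_ops_bound[OF A] by blast
  show scale: "adj X A (smult_fun c f) = smult_fun c (adj X A f)"
    if c: "c \<in> scalars X" and f: "f \<in> vectors X" for c f
  proof (rule ip_eqI)
    fix h assume h: "h \<in> vectors X"
    have "ip X h (adj X A (smult_fun c f)) = ip X (A h) (smult_fun c f)"
      using ip_adj[OF A vectors_scale[OF c f] h] by simp
    also have "\<dots> = cnj c * ip X (A h) f"
      using ip_scale_right[OF c f mem(2)[OF h]] .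
    also have "\<dots> = ip X h (smult_fun c (adj X A f))"
      using ip_scale_right[OF c mem(1)[OF f] h] ip_adj[OF A f h] by simp
    finally show "ip X h (adj X A (smult_fun c f)) = ip X h (smult_fun c (adj X A f))" .
  qed (rule mem(1) vectors_scale c f)+
  show "H.bop (adj X A)"
  proof (rule H.bopI[where C = C])
    show "adj X A f \<in> vectors X" if "f \<in> vectors X" for f using mem(1)[OF that] .
    show "adj X A (f + g) = adj X A f + adj X A g" if f: "f \<in> vectors X" and g: "g \<in> vectors X" for f g
    proof (rule ip_eqI)
      fix h assume h: "h \<in> vectors X"
      show "ip X h (adj X A (f + g)) = ip X h (adj X A f + adj X A g)"
        using ip_adj[OF A H.add_mem[OF f g] h] ip_adj[OF A f h] ip_adj[OF A g h]
          ip_add_right[OF f g mem(2)[OF h]] ip_add_right[OF mem(1)[OF f] mem(1)[OF g] h]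
        by simp
    qed (rule mem(1) H.add_mem f g)+
    show "adj X A (c *\<^sub>R f) = c *\<^sub>R adj X A f" if "f \<in> vectors X" for c f
      using scale[OF of_real_scalars that] by (simp add: scaleR_fun_eq)
    show "H.nrm (adj X A g) \<le> C * H.nrm g" if g: "g \<in> vectors X" for g
    proof -
      define h where "h = adj X A g"
      have h: "h \<in> vectors X" using mem(1)[OF g] by (simp add: h_def)
      have "(hnorm X h)\<^sup>2 = cmod (ip X (A h) g)"
        using ip_adj[OF A g h] ip_self[OF h] by (simp add: h_def norm_power)
      also have "\<dots> \<le> hnorm X (A h) * hnorm X g"
        using ip_cauchy_schwarz[OF mem(2)[OF h] g] .
      also have "\<dots> \<le> (C * hnorm X h) * hnorm X g"
        using C(2)[OF h] g by (intro mult_right_mono) (simp_all add: hnorm_eq_nrm)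
      finally have "hnorm X h * hnorm X h \<le> (C * hnorm X g) * hnorm X h"
        by (simp add: power2_eq_square ac_simps)
      then have "hnorm X h \<le> C * hnorm X g"
        using h g C(1) H.nrm_nonneg[OF h] H.nrm_nonneg[OF g]
        unfolding hnorm_eq_nrm by (cases "H.nrm h = 0") auto
      then show ?thesis by (simp add: h_def hnorm_eq_nrm)
    qed
  qed
qed

section \<open>Comparison of the two functional calculi\<close>

lemma comp_bounded_ops:
  assumes "A \<in> bounded_ops X" "B \<in> bounded_ops X"
  shows "A \<circ> B \<in> bounded_ops X"
proof (rule bounded_opsI)
  show "H.bop (A \<circ> B)"
    using H.bop_comp[OF bounded_ops_bop[OF assms(1)] bounded_ops_bop[OF assms(2)]] by (simp add: o_def)
  show "(A \<circ> B) (smult_fun c f) = smult_fun c ((A \<circ> B) f)" if "c \<in> scalars X" "f \<in> vectors X" for c f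
    using bounded_ops_scale[OF assms(2) that]
      bounded_ops_scale[OF assms(1) that(1) bounded_ops_mem[OF assms(2) that(2)]] by simp
qed

lemma op_lincomb_eq: "op_lincomb a S b T = (\<lambda>f. a *\<^sub>R S f + b *\<^sub>R T f)"
  by (simp add: op_lincomb_def scaleR_fun_eq plus_fun_eq)

lemma op_lincomb_bounded_ops:
  assumes "S \<in> bounded_ops X" "T \<in> bounded_ops X"
  shows "op_lincomb a S b T \<in> bounded_ops X"
proof (rule bounded_opsI)
  show "H.bop (op_lincomb a S b T)"
    using H.bop_lincomb[OF assms[THEN bounded_ops_bop]] by (simp add: op_lincomb_eq)
  show "op_lincomb a S b T (smult_fun c f) = smult_fun c (op_lincomb a S b T f)"
    if "c \<in> scalars X" "f \<in> vectors X" for c f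
    using bounded_ops_scale[OF assms(1) that] bounded_ops_scale[OF assms(2) that]
    by (simp add: op_lincomb_def algebra_simps)
qed

lemma op_poly_eq_papp: "op_poly p T f = H.papp p T f"
  by (rule ext) (simp add: op_poly_def H.papp_def sum_fun_apply scaleR_fun_eq)

lemma papp_scale:
  assumes "T \<in> bounded_ops X" "c \<in> scalars X" "f \<in> vectors X"
  shows "H.papp p T (smult_fun c f) = smult_fun c (H.papp p T f)"
  using assms(3)
proof (induction p arbitrary: f)
  case (pCons a p)
  then show ?case
    using bounded_ops_scale[OF assms(1,2)] bounded_ops_mem[OF assms(1)]
    by (simp add: H.papp_pCons scaleR_fun_eq plus_fun_eq algebra_simps)
qed (simp add: zero_fun_def)

text \<open>
  At a real point \<open>t\<close> it does not matter whether the inverse of \<open>T - t\<close> is sought among the real linear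
  or the scalar linear operators: the inverse of a scalar linear map is scalar linear.
\<close>

lemma op_spectrum_eq_spec:
  assumes T: "T \<in> bounded_ops X"
  shows "{t. complex_of_real t \<in> op_spectrum X T} = H.spec T"
proof -
  have inv_iff: "(\<exists>S\<in>bounded_ops X. \<forall>f\<in>vectors X. S (\<lambda>x. T f x - complex_of_real t * f x) = f
      \<and> (\<lambda>x. T (S f) x - complex_of_real t * S f x) = f)
    \<longleftrightarrow> H.invertible_op (\<lambda>f. T f - t *\<^sub>R f)" (is "?L \<longleftrightarrow> ?R") for t
  proof
    assume ?L
    then obtain S where "S \<in> bounded_ops X" "\<forall>f\<in>vectors X. S (T f - t *\<^sub>R f) = f \<and> T (S f) - t *\<^sub>R S f = f"
      unfolding scaleR_fun_eq minus_fun_eq by blast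
    then show ?R
      unfolding H.invertible_op_def by (intro exI[of _ S] conjI bounded_ops_bop)
  next
    assume ?R
    then obtain S where S: "H.bop S" "\<forall>f\<in>vectors X. S (T f - t *\<^sub>R f) = f \<and> T (S f) - t *\<^sub>R S f = f"
      unfolding H.invertible_op_def by blast
    have "S (smult_fun c f) = smult_fun c (S f)" if c: "c \<in> scalars X" and f: "f \<in> vectors X" for c f
    proof -
      define g where "g = smult_fun c (S f)"
      have Sf: "S f \<in> vectors X" using H.bop_mem[OF S(1) f] .
      have g: "g \<in> vectors X" using vectors_scale[OF c Sf] by (simp add: g_def)
      have "T g - t *\<^sub>R g = smult_fun c (T (S f) - t *\<^sub>R S f)"
        using bounded_ops_scale[OF T c Sf]
        by (simp add: g_def minus_fun_eq scaleR_fun_eq algebra_simps)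
      also have "\<dots> = smult_fun c f" using S(2) f by simp
      finally show ?thesis using S(2) g by (metis g_def)
    qed
    then have "S \<in> bounded_ops X" using bounded_opsI[OF S(1)] by blast
    then show ?L
      using S(2) unfolding scaleR_fun_eq minus_fun_eq by (intro bexI[of _ S])
  qed
  then show ?thesis
    by (simp only: op_spectrum_def H.spec_def mem_Collect_eq of_real_scalars inv_iff simp_thms)
qed

lemma unit_ball_zero: "(\<lambda>x. 0) \<in> {f \<in> vectors X. hnorm X f \<le> 1}"
  using vectors_zero H.nrm_zero unfolding hnorm_eq_nrm zero_fun_def by simp

lemma op_norm_le:
  assumes "e \<ge> 0" "\<And>f. f \<in> vectors X \<Longrightarrow> hnorm X (D f) \<le> e * hnorm X f"
  shows "op_norm X D \<le> e"
  unfolding op_norm_def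
proof (rule cSUP_least)
  show "{f \<in> vectors X. hnorm X f \<le> 1} \<noteq> {}" using unit_ball_zero by blast
  fix f assume "f \<in> {f \<in> vectors X. hnorm X f \<le> 1}"
  then show "hnorm X (D f) \<le> e"
    using order_trans[OF assms(2)[of f] mult_left_mono[of "hnorm X f" 1 e]] assms(1) by simp
qed

lemma hnorm_le_op_norm_unit:
  assumes "H.bop D" "f \<in> vectors X" "hnorm X f \<le> 1"
  shows "hnorm X (D f) \<le> op_norm X D"
  unfolding op_norm_def
proof (rule cSUP_upper)
  obtain C where C: "C > 0" "\<And>f. f \<in> vectors X \<Longrightarrow> H.nrm (D f) \<le> C * H.nrm f"
    using H.bop_bound[OF assms(1)] by blast
  have "hnorm X (D f) \<le> C" if "f \<in> vectors X" "hnorm X f \<le> 1" for f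
    using order_trans[OF C(2)[OF that(1)] mult_left_mono[of "H.nrm f" 1 C]] C(1) that(2)
    by (simp add: hnorm_eq_nrm)
  then show "bdd_above ((\<lambda>f. hnorm X (D f)) ` {f \<in> vectors X. hnorm X f \<le> 1})"
    by (intro bdd_aboveI2[where M = C]) blast
qed (use assms in simp)

lemma op_norm_nonneg:
  assumes "H.bop D"
  shows "0 \<le> op_norm X D"
  using order_trans[OF _ hnorm_le_op_norm_unit[OF assms, of 0]] H.bop_mem[OF assms, of 0]
  by (simp add: hnorm_eq_nrm)

lemma hnorm_le_op_norm:
  assumes D: "H.bop D" and f: "f \<in> vectors X"
  shows "hnorm X (D f) \<le> op_norm X D * hnorm X f"
proof (cases "H.nrm f = 0")
  case True
  then have "f = 0" using f by simp
  then have "D f = 0" using H.bop_scale[OF D f, of 0] by simp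
  then show ?thesis using \<open>f = 0\<close> by (simp add: hnorm_eq_nrm)
next
  case False
  then have pos: "H.nrm f > 0" "f \<noteq> 0" using H.nrm_nonneg[OF f] by auto
  define g where "g = (1 / H.nrm f) *\<^sub>R f"
  have g: "g \<in> vectors X" "H.nrm g = 1"
    using f pos by (simp_all add: g_def H.nrm_scale)
  have "H.nrm (D g) = H.nrm (D f) / H.nrm f"
    using H.bop_scale[OF D f] H.nrm_scale[OF H.bop_mem[OF D f]] pos by (simp add: g_def)
  then show ?thesis
    using mult_right_mono[OF hnorm_le_op_norm_unit[OF D g(1)], of "H.nrm f"] g(2) pos
    by (simp add: hnorm_eq_nrm)
qed

text \<open>
  The operators \<open>q(T)\<close> commute with multiplication by scalars, and \<open>S\<close> is their limit.
\<close>

lemma calculus_bounded_ops: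
  assumes T: "T \<in> bounded_ops X" and appr: "H.approximable_on_spec T \<phi>" and S: "H.is_calculus T \<phi> S"
  shows "S \<in> bounded_ops X"
proof (rule bounded_opsI[OF H.is_calculus_bop[OF S]])
  fix c f assume c: "c \<in> scalars X" and f: "f \<in> vectors X"
  note Smem = H.bop_mem[OF H.is_calculus_bop[OF S]]
  note cf = vectors_scale[OF c f]
  have "H.nrm (S (smult_fun c f) - smult_fun c (S f)) \<le> 0"
  proof (rule le_if_le_plus_multiples)
    fix e :: real assume "e > 0"
    then obtain q where q: "\<And>t. t \<in> H.spec T \<Longrightarrow> \<bar>poly q t - \<phi> t\<bar> \<le> e"
      using H.approximableD[OF appr] by blast
    define u where "u = H.papp q T f"
    have u: "u \<in> vectors X" "H.papp q T (smult_fun c f) = smult_fun c u"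
      using H.papp_mem[OF bounded_ops_bop[OF T] f] papp_scale[OF T c f] by (simp_all add: u_def)
    have "H.nrm (S (smult_fun c f) - smult_fun c u) \<le> e * (cmod c * H.nrm f)"
      using H.is_calculusD[OF S q cf] u(2) hnorm_scale[OF c f]
        H.nrm_minus_commute[OF Smem[OF cf] vectors_scale[OF c u(1)]]
      by (simp add: hnorm_eq_nrm)
    moreover have "H.nrm (smult_fun c u - smult_fun c (S f)) \<le> cmod c * (e * H.nrm f)"
    proof -
      have "smult_fun c u - smult_fun c (S f) = smult_fun c (u - S f)"
        by (simp add: fun_eq_iff algebra_simps)
      then show ?thesis
        using hnorm_scale[OF c H.diff_mem[OF u(1) Smem[OF f]]] H.is_calculusD[OF S q f]
        by (simp add: hnorm_eq_nrm u_def mult_left_mono)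
    qed
    ultimately show "H.nrm (S (smult_fun c f) - smult_fun c (S f)) \<le> 0 + e * (2 * cmod c * H.nrm f)"
      using H.nrm_triangle_diff[OF Smem[OF cf] vectors_scale[OF c u(1)] vectors_scale[OF c Smem[OF f]]]
      by (simp add: algebra_simps)
  qed
  moreover have mem: "S (smult_fun c f) - smult_fun c (S f) \<in> vectors X"
    by (intro H.diff_mem Smem cf vectors_scale c f)
  ultimately have "H.nrm (S (smult_fun c f) - smult_fun c (S f)) = 0"
    using H.nrm_nonneg[OF mem] by simp
  then have "S (smult_fun c f) - smult_fun c (S f) = 0"
    using mem H.nrm_eq_0 by blast
  then show "S (smult_fun c f) = smult_fun c (S f)" by simp
qed

text \<open>
  An operator with the property that defines the chosen \<open>cfc X \<phi> T\<close> exists, namely \<open>\<phi>(T)\<close> as constructed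
  above. Along one approximating sequence of polynomials the chosen operator has the same limit, so the
  two agree on the space.
\<close>

lemma cfc_is_calculus:
  assumes T: "T \<in> bounded_ops X" "H.symm T" and ne: "\<exists>f\<in>vectors X. f \<noteq> 0"
    and appr: "H.approximable_on_spec T \<phi>"
  shows "H.is_calculus T \<phi> (cfc X \<phi> T)"
proof -
  note T' = bounded_ops_bop[OF T(1)] T(2)
  obtain S where S: "H.is_calculus T \<phi> S"
    using H.calculus_exists[OF T' ne appr] by blast
  define P where "P S \<longleftrightarrow> S \<in> bounded_ops X \<and>
     (\<forall>p :: nat \<Rightarrow> real poly. uniform_limit (H.spec T) (\<lambda>n. poly (p n)) \<phi> sequentially
        \<longrightarrow> (\<lambda>n. op_norm X (op_lincomb 1 (op_poly (p n) T) (- 1) S)) \<longlonglongrightarrow> 0)" for S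
  have diff: "op_lincomb 1 (op_poly q T) (- 1) R = (\<lambda>f. H.papp q T f - R f)" for q R
    by (simp add: op_lincomb_eq op_poly_eq_papp fun_eq_iff)
  have diff_bop: "H.bop (\<lambda>f. H.papp q T f - R f)" if "H.bop R" for q R
    using H.bop_lincomb[OF H.bop_papp[OF T'(1), of q] that, of 1 "-1"] by simp
  have "P S"
    unfolding P_def
  proof (intro conjI allI impI)
    show "S \<in> bounded_ops X" using calculus_bounded_ops[OF T(1) appr S] .
    fix p :: "nat \<Rightarrow> real poly"
    assume lim: "uniform_limit (H.spec T) (\<lambda>n. poly (p n)) \<phi> sequentially"
    show "(\<lambda>n. op_norm X (op_lincomb 1 (op_poly (p n) T) (- 1) S)) \<longlonglongrightarrow> 0"
    proof (rule tendstoI)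
      fix e :: real assume "e > 0"
      then have "\<forall>\<^sub>F n in sequentially. \<forall>t\<in>H.spec T. dist (poly (p n) t) (\<phi> t) < e / 2"
        using uniform_limitD[OF lim, of "e / 2"] by simp
      then show "\<forall>\<^sub>F n in sequentially. dist (op_norm X (op_lincomb 1 (op_poly (p n) T) (- 1) S)) 0 < e"
      proof (rule eventually_mono)
        fix n assume n: "\<forall>t\<in>H.spec T. dist (poly (p n) t) (\<phi> t) < e / 2"
        have "op_norm X (\<lambda>f. H.papp (p n) T f - S f) \<le> e / 2"
        proof (rule op_norm_le)
          fix f assume f: "f \<in> vectors X"
          have "H.nrm (H.papp (p n) T f - S f) \<le> e / 2 * H.nrm f"
            by (rule H.is_calculusD[OF S _ f]) (use n in \<open>force simp: dist_real_def\<close>)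
          then show "hnorm X (H.papp (p n) T f - S f) \<le> e / 2 * hnorm X f"
            by (simp add: hnorm_eq_nrm)
        qed (use \<open>e > 0\<close> in simp)
        then show "dist (op_norm X (op_lincomb 1 (op_poly (p n) T) (- 1) S)) 0 < e"
          using op_norm_nonneg[OF diff_bop[OF H.is_calculus_bop[OF S]], of "p n"] \<open>e > 0\<close>
          by (simp add: diff dist_real_def)
      qed
    qed
  qed
  define R where "R = cfc X \<phi> T"
  have "R = (SOME S. P S)"
    unfolding R_def cfc_def P_def op_spectrum_eq_spec[OF T(1)] ..
  then have "P R" using someI[of P, OF \<open>P S\<close>] by simp
  then have R: "R \<in> bounded_ops X" by (simp add: P_def)
  obtain \<epsilon> p where \<epsilon>: "\<epsilon> \<longlonglongrightarrow> 0" and p: "\<forall>n. \<forall>t\<in>H.spec T. \<bar>poly (p n) t - \<phi> t\<bar> \<le> \<epsilon> n"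
    using H.approximable_sequence[OF appr] by blast
  have "uniform_limit (H.spec T) (\<lambda>n. poly (p n)) \<phi> sequentially"
  proof (rule uniform_limitI)
    fix e :: real assume "e > 0"
    have "\<forall>\<^sub>F n in sequentially. \<epsilon> n < e" using order_tendstoD(2)[OF \<epsilon> \<open>e > 0\<close>] .
    then show "\<forall>\<^sub>F n in sequentially. \<forall>t\<in>H.spec T. dist (poly (p n) t) (\<phi> t) < e"
    proof (rule eventually_mono, intro ballI)
      fix n t assume "\<epsilon> n < e" "t \<in> H.spec T"
      then show "dist (poly (p n) t) (\<phi> t) < e"
        using bspec[OF spec[OF p, of n], of t] by (simp add: dist_real_def)
    qed
  qed
  then have lim: "(\<lambda>n. op_norm X (\<lambda>f. H.papp (p n) T f - R f)) \<longlonglongrightarrow> 0"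
    using \<open>P R\<close> unfolding P_def diff by blast
  have eq: "R f = S f" if f: "f \<in> vectors X" for f
  proof -
    note mem = bounded_ops_mem[OF R f] H.bop_mem[OF H.is_calculus_bop[OF S] f]
    have "H.nrm (R f - S f) \<le> 0"
    proof (rule LIMSEQ_le_const)
      show "(\<lambda>n. (op_norm X (\<lambda>f. H.papp (p n) T f - R f) + \<epsilon> n) * H.nrm f) \<longlonglongrightarrow> 0"
        using tendsto_mult_left_zero[OF tendsto_add_zero[OF lim \<epsilon>]] .
      have "H.nrm (R f - S f) \<le> (op_norm X (\<lambda>f. H.papp (p n) T f - R f) + \<epsilon> n) * H.nrm f" for n
      proof -
        have pm: "H.papp (p n) T f \<in> vectors X" using H.papp_mem[OF T'(1) f] .
        have "H.nrm (R f - H.papp (p n) T f) \<le> op_norm X (\<lambda>f. H.papp (p n) T f - R f) * H.nrm f"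
          using hnorm_le_op_norm[OF diff_bop[OF bounded_ops_bop[OF R]] f, of "p n"]
            H.nrm_minus_commute[OF mem(1) pm] by (simp add: hnorm_eq_nrm)
        moreover have "H.nrm (H.papp (p n) T f - S f) \<le> \<epsilon> n * H.nrm f"
          by (rule H.is_calculusD[OF S _ f]) (use p in blast)
        ultimately show ?thesis
          using H.nrm_triangle_diff[OF mem(1) pm mem(2)] by (simp add: distrib_right)
      qed
      then show "\<exists>N. \<forall>n\<ge>N. H.nrm (R f - S f)
          \<le> (op_norm X (\<lambda>f. H.papp (p n) T f - R f) + \<epsilon> n) * H.nrm f"
        by blast
    qed
    then have "H.nrm (R f - S f) = 0"
      using H.nrm_nonneg[OF H.diff_mem[OF mem]] by simp
    then show ?thesis
      using H.nrm_eq_0[OF H.diff_mem[OF mem]] by simp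
  qed
  have "H.is_calculus T \<phi> R"
    using S bounded_ops_bop[OF R] eq unfolding H.is_calculus_def by simp
  then show ?thesis by (simp add: R_def)
qed

lemma op_powr_is_calculus:
  assumes T: "T \<in> bounded_ops X" "H.psd T" and ne: "\<exists>f\<in>vectors X. f \<noteq> 0" and s: "s > 0"
  shows "H.is_calculus T (\<lambda>t. t powr s) (op_powr X T s)"
    and "op_powr X T s \<in> bounded_ops X" and "H.psd (op_powr X T s)"
proof -
  have appr: "H.approximable_on_spec T (\<lambda>t. t powr s)"
    using H.psd_approximable_powr[OF T(2) s] .
  show calc: "H.is_calculus T (\<lambda>t. t powr s) (op_powr X T s)"
    unfolding op_powr_def
    using cfc_is_calculus[OF T(1) _ ne appr] T(2) by (simp add: H.psd_def)
  show "op_powr X T s \<in> bounded_ops X" using calculus_bounded_ops[OF T(1) appr calc] .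
  show "H.psd (op_powr X T s)" using H.psd_calculus_powr[OF T(2) ne s calc] .
qed

section \<open>The modulus of an operator\<close>

text \<open>
  All of this is \<open>\<langle>A\<^sup>* A f, g\<rangle> = \<langle>A f, A g\<rangle>\<close>.
\<close>

lemma adj_comp_psd:
  assumes A: "A \<in> bounded_ops X"
  shows "H.psd (adj X A \<circ> A)"
    and "f \<in> vectors X \<Longrightarrow> Re (ip X ((adj X A \<circ> A) f) f) = (hnorm X (A f))\<^sup>2"
proof -
  note mem = bounded_ops_mem[OF A] adj_mem[OF A]
  have 1: "Re (ip X f (adj X A (A g))) = Re (ip X (A f) (A g))"
    if "f \<in> vectors X" "g \<in> vectors X" for f g
    using ip_adj[OF A mem(1)[OF that(2)] that(1)] by simp
  have 2: "Re (ip X (adj X A (A f)) g) = Re (ip X (A f) (A g))"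
    if "f \<in> vectors X" "g \<in> vectors X" for f g
    using 1[OF that(2,1)] H.inn_commute[OF mem(2)[OF mem(1)[OF that(1)]] that(2)]
      H.inn_commute[OF mem(1)[OF that(1)] mem(1)[OF that(2)]] by simp
  show 3: "Re (ip X ((adj X A \<circ> A) f) f) = (hnorm X (A f))\<^sup>2" if "f \<in> vectors X" for f
    using 2[OF that that] H.nrm_sq[OF mem(1)[OF that]] by (simp add: hnorm_eq_nrm)
  show "H.psd (adj X A \<circ> A)"
    unfolding H.psd_def
  proof (intro conjI ballI)
    show "H.bop (adj X A \<circ> A)"
      using bounded_ops_bop[OF comp_bounded_ops[OF adj_bounded_ops[OF A] A]] .
    show "H.symm (adj X A \<circ> A)" by (simp add: H.symm_def 1 2)
    show "0 \<le> Re (ip X ((adj X A \<circ> A) f) f)" if "f \<in> vectors X" for f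
      unfolding 3[OF that] by simp
  qed
qed

text \<open>
  \<open>\<bar>A\<bar>\<^sup>2\<^sup>r\<close> arises by two successive powers, \<open>\<bar>A\<bar> = (A\<^sup>* A)\<^sup>1\<^sup>/\<^sup>2\<close> and then the power \<open>2 r\<close> of \<open>\<bar>A\<bar>\<close>. The first
  one enters through \<open>\<parallel>\<bar>A\<bar> f\<parallel> = \<parallel>A f\<parallel>\<close>, the second through Jensen's inequality.
\<close>

lemma modulus_power:
  assumes A: "A \<in> bounded_ops X" and ne: "\<exists>f\<in>vectors X. f \<noteq> 0" and r: "r \<ge> 1"
  shows modulus_power_bounded_ops: "op_powr X (modulus X A) (2 * r) \<in> bounded_ops X"
    and hnorm_powr_le_modulus_power: "\<lbrakk>f \<in> vectors X; hnorm X f = 1\<rbrakk>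
      \<Longrightarrow> hnorm X (A f) powr (2 * r) \<le> Re (ip X (op_powr X (modulus X A) (2 * r) f) f)"
proof -
  have P: "adj X A \<circ> A \<in> bounded_ops X" "H.psd (adj X A \<circ> A)"
    using comp_bounded_ops[OF adj_bounded_ops[OF A] A] adj_comp_psd(1)[OF A] by auto
  have half: "(1/2::real) > 0" by simp
  note M = op_powr_is_calculus[OF P ne half, folded modulus_def]
  have r2: "2 * r > 0" using r by simp
  note S = op_powr_is_calculus[OF M(2,3) ne r2]
  show "op_powr X (modulus X A) (2 * r) \<in> bounded_ops X" by (rule S(2))
  assume f: "f \<in> vectors X" "hnorm X f = 1"
  have "(H.nrm (modulus X A f))\<^sup>2 = (H.nrm (A f))\<^sup>2"
    using H.calculus_half_norm[OF P(2) ne M(1) f(1)] adj_comp_psd(2)[OF A f(1)]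
    by (simp add: hnorm_eq_nrm)
  then have "H.nrm (modulus X A f) = H.nrm (A f)"
    using H.nrm_nonneg[OF bounded_ops_mem[OF M(2) f(1)]] H.nrm_nonneg[OF bounded_ops_mem[OF A f(1)]]
    by simp
  then show "hnorm X (A f) powr (2 * r) \<le> Re (ip X (op_powr X (modulus X A) (2 * r) f) f)"
    using H.calculus_power_jensen[OF M(3) ne r S(1) f(1)] f(2) by (simp add: hnorm_eq_nrm)
qed

section \<open>Buzano's inequality and Berezin numbers\<close>

text \<open>
  With \<open>a = A x\<close> and \<open>b = A\<^sup>* x\<close>, the vector \<open>2 \<langle>a, x\<rangle> x - a\<close> is the reflection of \<open>a\<close> in the line
  through \<open>x\<close> and has the norm of \<open>a\<close>. Its inner product with \<open>b\<close> is \<open>2 \<langle>A x, x\<rangle>\<^sup>2 - \<langle>A\<^sup>2 x, x\<rangle>\<close>,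
  and Cauchy-Schwarz applies.
\<close>

lemma buzano_square:
  assumes A: "A \<in> bounded_ops X" and x: "x \<in> vectors X" "hnorm X x = 1"
  shows "2 * (cmod (ip X (A x) x))\<^sup>2 \<le> hnorm X (A x) * hnorm X (adj X A x) + cmod (ip X (A (A x)) x)"
proof -
  define a where "a = A x"
  define b where "b = adj X A x"
  define z where "z = ip X a x"
  have mem: "a \<in> vectors X" "b \<in> vectors X"
    using bounded_ops_mem[OF A x(1)] adj_mem[OF A x(1)] by (simp_all add: a_def b_def)
  have z: "z \<in> scalars X" using ip_value[OF mem(1) x(1)] by (simp add: z_def)
  have ab: "ip X a b = ip X (A a) x" "ip X x b = z"
    using ip_adj[OF A x(1) mem(1)] ip_adj[OF A x(1) x(1)] by (simp_all add: a_def b_def z_def)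
  have z2: "2 * z \<in> scalars X" using scalars z by (elim disjE) simp_all
  have m1: "- 1 \<in> scalars X" using of_real_scalars[of "-1"] by simp
  define c where "c = smult_fun (2 * z) x"
  define d where "d = smult_fun (- 1) a"
  have cd: "c \<in> vectors X" "d \<in> vectors X"
    using vectors_scale[OF z2 x(1)] vectors_scale[OF m1 mem(1)] by (simp_all add: c_def d_def)
  have xx: "ip X x x = 1" using ip_self[OF x(1)] x(2) by simp
  have xa: "ip X x a = cnj z" using ip_cnj[OF mem(1) x(1)] by (simp add: z_def)
  have "ip X (c + d) (c + d) = ip X a a"
    using cd ip_scale[OF z2 x(1)] ip_scale[OF m1 mem(1)] ip_scale_right[OF z2 x(1)]
      ip_scale_right[OF m1 mem(1)] mem x(1)
    by (simp add: ip_add_left ip_add_right c_def d_def xx xa flip: z_def)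
  then have norm: "hnorm X (c + d) = hnorm X a"
    by (simp add: hnorm_def)
  have "ip X (c + d) b = 2 * z\<^sup>2 - ip X (A a) x"
    using ip_add_left[OF cd mem(2)] ip_scale[OF z2 x(1) mem(2)] ip_scale[OF m1 mem(1,2)] ab
    by (simp add: c_def d_def power2_eq_square)
  then have "cmod (2 * z\<^sup>2 - ip X (A a) x) \<le> hnorm X a * hnorm X b"
    using ip_cauchy_schwarz[OF H.add_mem[OF cd] mem(2)] norm by simp
  moreover have "cmod (2 * z\<^sup>2) \<le> cmod (2 * z\<^sup>2 - ip X (A a) x) + cmod (ip X (A a) x)"
    using norm_triangle_ineq[of "2 * z\<^sup>2 - ip X (A a) x" "ip X (A a) x"] by simp
  ultimately show ?thesis
    by (simp add: norm_mult norm_power a_def b_def z_def)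
qed

lemma normalized_kernel_mem: "normalized_kernel X l \<in> vectors X"
  using vectors_scale[OF of_real_scalars repr_kernel_mem, of "1 / hnorm X (repr_kernel X l)" l]
  by (simp add: normalized_kernel_def)

lemma hnorm_normalized_kernel:
  assumes "repr_kernel X l \<noteq> (\<lambda>x. 0)"
  shows "hnorm X (normalized_kernel X l) = 1"
proof -
  have "hnorm X (repr_kernel X l) \<noteq> 0"
    using assms H.nrm_eq_0[OF repr_kernel_mem] by (simp add: hnorm_eq_nrm zero_fun_def)
  then show ?thesis
    using hnorm_scale[OF of_real_scalars repr_kernel_mem, of "1 / hnorm X (repr_kernel X l)" l]
      H.nrm_nonneg[OF repr_kernel_mem, of l]
    by (simp add: normalized_kernel_def hnorm_eq_nrm norm_divide)
qed

text \<open>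
  Boundedness of \<open>B\<close> makes the supremum in the Berezin number finite, so that it is an upper bound.
\<close>

lemma ber_upper:
  assumes B: "B \<in> bounded_ops X" and ker: "\<And>l. repr_kernel X l \<noteq> (\<lambda>x. 0)"
  shows "cmod (ip X (B (normalized_kernel X l)) (normalized_kernel X l)) \<le> ber X B"
  unfolding ber_def
proof (rule cSUP_upper)
  obtain C where C: "C > 0" "\<And>f. f \<in> vectors X \<Longrightarrow> hnorm X (B f) \<le> C * hnorm X f"
    using bounded_ops_bound[OF B] by blast
  have "cmod (ip X (B (normalized_kernel X l)) (normalized_kernel X l)) \<le> C" for l
    using ip_cauchy_schwarz[OF bounded_ops_mem[OF B normalized_kernel_mem] normalized_kernel_mem, of l l]
      C(2)[OF normalized_kernel_mem, of l] hnorm_normalized_kernel[OF ker, of l] by simp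
  then show "bdd_above (range (\<lambda>l. cmod (ip X (B (normalized_kernel X l)) (normalized_kernel X l))))"
    by (intro bdd_aboveI2[where M = C])
qed simp

lemma ber_nonneg:
  assumes "B \<in> bounded_ops X" "\<And>l. repr_kernel X l \<noteq> (\<lambda>x. 0)"
  shows "0 \<le> ber X B"
  using order_trans[OF norm_ge_zero ber_upper[OF assms]] .

lemma ber_powr_le:
  assumes "0 \<le> K" "s > 0" "0 \<le> ber X A"
    and "\<And>l. cmod (ip X (A (normalized_kernel X l)) (normalized_kernel X l)) powr s \<le> K"
  shows "ber X A powr s \<le> K"
proof -
  have "ber X A \<le> K powr (1 / s)"
    unfolding ber_def
  proof (rule cSUP_least)
    fix l
    define w where "w = cmod (ip X (A (normalized_kernel X l)) (normalized_kernel X l))"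
    have "(w powr s) powr (1 / s) \<le> K powr (1 / s)"
      using assms(2,4) by (intro powr_mono2) (auto simp: w_def)
    then show "w \<le> K powr (1 / s)"
      using assms(2) by (simp add: powr_powr w_def)
  qed simp
  then have "ber X A powr s \<le> (K powr (1 / s)) powr s"
    using assms by (intro powr_mono2) auto
  then show ?thesis using assms by (simp add: powr_powr)
qed

end

theorem theorem2p9:
  fixes X :: "'a fun_space" and A :: "'a op" and r \<alpha> :: real
  assumes "rkhs X"
    and "\<And>l. repr_kernel X l \<noteq> (\<lambda>x. 0)"
    and "A \<in> bounded_ops X"
    and "r \<ge> 1"
    and "\<alpha> \<in> {0..1}"
  shows "ber X A powr (2 * r) \<le> \<alpha> / 2 * ber X (A \<circ> A) powr r +
           ber X (op_lincomb (\<alpha> / 4) (op_powr X (modulus X A) (2 * r))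
                   (1 - 3 / 4 * \<alpha>) (op_powr X (modulus X (adj X A)) (2 * r)))
         \<and> ber X A powr (2 * r) \<le> \<alpha> / 2 * ber X (A \<circ> A) powr r +
           ber X (op_lincomb (1 - 3 / 4 * \<alpha>) (op_powr X (modulus X A) (2 * r))
                   (\<alpha> / 4) (op_powr X (modulus X (adj X A)) (2 * r)))"
proof -
  interpret rkhs X by (rule assms(1))
  note A = assms(3) and ker = assms(2) and r = assms(4) and \<alpha> = assms(5)
  note A' = adj_bounded_ops[OF A]
  have ne: "\<exists>f\<in>vectors X. f \<noteq> 0"
    using repr_kernel_mem ker by (metis zero_fun_def)
  define S where "S = op_powr X (modulus X A) (2 * r)"
  define S' where "S' = op_powr X (modulus X (adj X A)) (2 * r)"
  have S: "S \<in> bounded_ops X" "S' \<in> bounded_ops X"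
    using modulus_power_bounded_ops[OF A ne r] modulus_power_bounded_ops[OF A' ne r]
    by (simp_all add: S_def S'_def)
  \<comment> \<open>Both inequalities pass from the pointwise numbers to Berezin numbers in the same way.\<close>
  have bound: "ber X A powr (2 * r) \<le> \<alpha> / 2 * ber X (A \<circ> A) powr r + ber X (op_lincomb c S d S')"
    if cd: "0 \<le> c" "0 \<le> d" and pointwise:
      "\<And>a b w z. \<lbrakk>0 \<le> a; 0 \<le> b; 0 \<le> w; 0 \<le> z; w \<le> a; w \<le> b; 2 * w\<^sup>2 \<le> a * b + z\<rbrakk>
        \<Longrightarrow> w powr (2 * r) \<le> \<alpha> / 2 * z powr r + (c * a powr (2 * r) + d * b powr (2 * r))" for c d
  proof (rule ber_powr_le)
    note L = op_lincomb_bounded_ops[OF S, of c d]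
    show "0 \<le> \<alpha> / 2 * ber X (A \<circ> A) powr r + ber X (op_lincomb c S d S')"
      using \<alpha> ber_nonneg[OF L ker] by simp
    show "0 < 2 * r" using r by simp
    show "0 \<le> ber X A" using ber_nonneg[OF A ker] .
    fix l
    define x where "x = normalized_kernel X l"
    have x: "x \<in> vectors X" "hnorm X x = 1"
      using normalized_kernel_mem hnorm_normalized_kernel[OF ker] by (simp_all add: x_def)
    define a where "a = hnorm X (A x)"
    define b where "b = hnorm X (adj X A x)"
    define w where "w = cmod (ip X (A x) x)"
    define z where "z = cmod (ip X (A (A x)) x)"
    have nonneg: "0 \<le> a" "0 \<le> b" "0 \<le> w" "0 \<le> z"
      using H.nrm_nonneg[OF bounded_ops_mem[OF A x(1)]] H.nrm_nonneg[OF bounded_ops_mem[OF A' x(1)]]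
      by (simp_all add: a_def b_def w_def z_def hnorm_eq_nrm)
    have "w \<le> a"
      using ip_cauchy_schwarz[OF bounded_ops_mem[OF A x(1)] x(1)] x(2) by (simp add: w_def a_def)
    moreover have "w \<le> b"
      using ip_cauchy_schwarz[OF x(1) bounded_ops_mem[OF A' x(1)]] ip_adj[OF A x(1) x(1)] x(2)
      by (simp add: w_def b_def)
    moreover have "2 * w\<^sup>2 \<le> a * b + z"
      using buzano_square[OF A x] by (simp add: a_def b_def w_def z_def)
    ultimately have "w powr (2 * r) \<le> \<alpha> / 2 * z powr r + (c * a powr (2 * r) + d * b powr (2 * r))"
      using pointwise[OF nonneg] by simp
    also have "\<dots> \<le> \<alpha> / 2 * ber X (A \<circ> A) powr r + ber X (op_lincomb c S d S')"
    proof (rule add_mono)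
      have "z \<le> ber X (A \<circ> A)"
        using ber_upper[OF comp_bounded_ops[OF A A] ker, of l] by (simp add: z_def x_def)
      then show "\<alpha> / 2 * z powr r \<le> \<alpha> / 2 * ber X (A \<circ> A) powr r"
        using \<alpha> r nonneg(4) by (intro mult_left_mono powr_mono2) auto
      have "c * a powr (2 * r) + d * b powr (2 * r) \<le> c * Re (ip X (S x) x) + d * Re (ip X (S' x) x)"
        using hnorm_powr_le_modulus_power[OF A ne r x] hnorm_powr_le_modulus_power[OF A' ne r x] cd
        by (intro add_mono mult_left_mono) (simp_all add: a_def b_def S_def S'_def)
      also have "\<dots> = Re (ip X (op_lincomb c S d S' x) x)"
        using bounded_ops_mem[OF S(1) x(1)] bounded_ops_mem[OF S(2) x(1)] x(1)
        by (simp add: op_lincomb_eq H.inn_simps)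
      also have "\<dots> \<le> ber X (op_lincomb c S d S')"
        using order_trans[OF complex_Re_le_cmod ber_upper[OF L ker, of l]] by (simp add: x_def)
      finally show "c * a powr (2 * r) + d * b powr (2 * r) \<le> ber X (op_lincomb c S d S')" .
    qed
    finally show "cmod (ip X (A (normalized_kernel X l)) (normalized_kernel X l)) powr (2 * r)
        \<le> \<alpha> / 2 * ber X (A \<circ> A) powr r + ber X (op_lincomb c S d S')"
      by (simp add: w_def x_def)
  qed
  have "ber X A powr (2 * r) \<le> \<alpha> / 2 * ber X (A \<circ> A) powr r
      + ber X (op_lincomb (\<alpha> / 4) S (1 - 3 / 4 * \<alpha>) S')"
    using \<alpha> r by (intro bound power_mean_step) auto
  moreover have "ber X A powr (2 * r) \<le> \<alpha> / 2 * ber X (A \<circ> A) powr r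
      + ber X (op_lincomb (1 - 3 / 4 * \<alpha>) S (\<alpha> / 4) S')"
  proof (rule bound)
    fix a b w z :: real
    assume "0 \<le> a" "0 \<le> b" "0 \<le> w" "0 \<le> z" "w \<le> a" "2 * w\<^sup>2 \<le> a * b + z"
    then show "w powr (2 * r) \<le> \<alpha> / 2 * z powr r
        + ((1 - 3 / 4 * \<alpha>) * a powr (2 * r) + \<alpha> / 4 * b powr (2 * r))"
      \<comment> \<open>The roles of \<open>\<parallel>A x\<parallel>\<close> and \<open>\<parallel>A\<^sup>* x\<parallel>\<close> are exchanged here.\<close>
      using power_mean_step[of b a w z r \<alpha>] \<alpha> r by (simp add: ac_simps)
  qed (use \<alpha> in auto)
  ultimately show ?thesis
    by (simp add: S_def S'_def)
qed

end
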